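(* Let \(X, Y \subseteq \operatorname{Homeo}_+(I)\) be geometrically fast sets, each having only finitely many transition points, and suppose their dynamical diagrams \(D_X\) and \(D_Y\) are isomorphic. Let \(\tau : X \to Y\) be the bijection between edge labels induced by the isomorphism. Then \(\tau\) extends to an isomorphism \(\phi : \langle X\rangle \to \langle Y\rangle\). Moreover, there is an order preserving bijection \(\theta : M\langle X\rangle \to M\langle Y\rangle\) such that for every \(f \in \langle X\rangle\) and every \(t \in M\langle X\rangle\), \((tf)\theta = (t\theta)\phi(f)\); i.e. \(f \mapsto f^\theta = \theta^{-1} f \theta\) induces the isomorphism \(\langle X\rangle \cong \langle Y\rangle\).
   Context: \(I=[0,1]\) and \(\operatorname{Homeo}_+(I)\) is the group of orientation preserving homeomorphisms of \(I\), acting on the right: \(tg\) denotes the image of \(t\) under \(g\), and \(fg\) means apply \(f\) first. The support of \(f\) is \(\operatorname{supt}(f)=\{t\in I : tf\neq t\}\); an orbital of \(f\) is a connected component of \(\operatorname{supt}(f)\). A left (right) transition point of \(f\) is a point \(t\notin\operatorname{supt}(f)\) such that for every \(\epsilon>0\), \((t,t+\epsilon)\cap\operatorname{supt}(f)\neq\emptyset\) (resp. \((t-\epsilon,t)\cap\operatorname{supt}(f)\neq\emptyset\)). A transition point of a set is a transition point of one of its elements. A bump is an element of \(\operatorname{Homeo}_+(I)\) with exactly one orbital; it is positive if \(ta>t\) on its support. A bump \(b\) is a signed bump of \(f\) if \(b\) agrees with \(f\) on \(\operatorname{supt}(b)\). A positive bump \(a\) is used in \(X\subseteq\operatorname{Homeo}_+(I)\)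 if some \(f\in X\) agrees with \(a\) or with \(a^{-1}\) on \(\operatorname{supt}(a)\). A set \(X\subseteq \operatorname{Homeo}_+(I)\) is geometrically proper if no point of \(I\) is a left transition point of two distinct elements of \(X\) and no point is a right transition point of two distinct elements of \(X\). A marking of a geometrically proper set \(A\) of positive bumps assigns to each \(a\in A\) a marker \(t\in\operatorname{supt}(a)\); if \(a\) has orbital \((x,y)\) and marker \(t\), its source is \(\operatorname{src}(a)=(x,t)\) and destination is \(\operatorname{dest}(a)=[ta,y)\), and \(\operatorname{src}(a^{-1}):=\operatorname{dest}(a)\), \(\operatorname{dest}(a^{-1}):=\operatorname{src}(a)\); these intervals are the feet. \(A\) is geometrically fast if it is geometrically proper and has a marking for which all feet of elements of \(A\) are pairwise disjoint. A set \(X\subseteq\operatorname{Homeo}_+(I)\) is geometrically fast if it is geometrically proper and the set of bumps used in \(X\) is geometrically fast. Dynamical diagram: for geometrically fast \(X\) with finitely many transition points (marking the bumps used in \(X\) so that the feet are disjoint), \(D_X\) is the directed graph whose vertices are the feet, linearly ordered by the order of \(I\), whose edges are the signed bumps of elements of \(X\), each directed from its source to its destination and labeled by the element of \(X\) it comes from. An isomorphism of dynamical diagrams is an order preserving bijection of vertices which is a directed graph isomorphism and induces a bijection between the label sets (two edges have equal labels iff their images do). Canonical marking and \(M\langle X\rangle\): let \(A\) be the finite set of bumps used in \(X\). An element of \(A\) is isolated if its support contains no transition point of \(A\); \(a\in A\) is initial if it is isolated or the least transition point of \(A\) in \(\operatorname{supt}(a)\) is not a right transition point of any element of \(A\). Enumerate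 \(A=\{a_0,\dots,a_n\}\) with increasing left transition points; let \(s_k\) be the least transition point of \(A\) in \(\operatorname{supt}(a_k)\) (the midpoint of \(\operatorname{supt}(a_k)\) if \(a_k\) is isolated); set \(t_k=s_k\) if \(a_k\) is initial, and otherwise \(t_k=t_ja_j\) where \(s_k\) is the right transition point of \(a_j\), \(j<k\). The marking \(a_k\mapsto t_k\) is the canonical marking. \(M_X\) is the set of \(t_k\) with \(a_k\) initial, and \(M\langle X\rangle=\{tg : t\in M_X,\ g\in\langle X\rangle\}\); similarly for \(Y\). *)

theory Defs
  imports "HOL-Analysis.Analysis"
begin

text \<open>Elements of Homeo_+(I), I = [0,1], are represented by functions real \<Rightarrow> real that are
  increasing homeomorphisms of [0,1] and the identity outside [0,1] (canonical representatives).
  The action is on the right: tg is written  g t , and fg (apply f first) is  g \<circ> f .\<close>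

definition homeo_plus :: "(real \<Rightarrow> real) \<Rightarrow> bool" where
  "homeo_plus f \<longleftrightarrow> (\<exists>g. homeomorphism {0..1} {0..1} f g) \<and> mono_on {0..1} f
     \<and> (\<forall>x. x \<notin> {0..1} \<longrightarrow> f x = x)"

definition supt :: "(real \<Rightarrow> real) \<Rightarrow> real set" where
  "supt f = {t \<in> {0..1}. f t \<noteq> t}"

definition orbitals :: "(real \<Rightarrow> real) \<Rightarrow> real set set" where
  "orbitals f = components (supt f)"

definition left_tp :: "(real \<Rightarrow> real) \<Rightarrow> real \<Rightarrow> bool" where
  "left_tp f t \<longleftrightarrow> t \<in> {0..1} \<and> t \<notin> supt f \<and> (\<forall>\<epsilon>>0. {t<..<t+\<epsilon>} \<inter> supt f \<noteq> {})"

definition right_tp :: "(real \<Rightarrow> real) \<Rightarrow> real \<Rightarrow> bool" where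
  "right_tp f t \<longleftrightarrow> t \<in> {0..1} \<and> t \<notin> supt f \<and> (\<forall>\<epsilon>>0. {t-\<epsilon><..<t} \<inter> supt f \<noteq> {})"

definition trans_pts :: "(real \<Rightarrow> real) set \<Rightarrow> real set" where
  "trans_pts S = {t. \<exists>f\<in>S. left_tp f t \<or> right_tp f t}"

definition bump :: "(real \<Rightarrow> real) \<Rightarrow> bool" where
  "bump f \<longleftrightarrow> homeo_plus f \<and> (\<exists>!C. C \<in> orbitals f)"

definition pos_bump :: "(real \<Rightarrow> real) \<Rightarrow> bool" where
  "pos_bump a \<longleftrightarrow> bump a \<and> (\<forall>t\<in>supt a. a t > t)"

definition signed_bump :: "(real \<Rightarrow> real) \<Rightarrow> (real \<Rightarrow> real) \<Rightarrow> bool" where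
  "signed_bump b f \<longleftrightarrow> bump b \<and> (\<forall>t\<in>supt b. b t = f t)"

definition used_in :: "(real \<Rightarrow> real) \<Rightarrow> (real \<Rightarrow> real) set \<Rightarrow> bool" where
  "used_in a X \<longleftrightarrow> pos_bump a \<and>
     (\<exists>f\<in>X. (\<forall>t\<in>supt a. f t = a t) \<or> (\<forall>t\<in>supt a. f t = inv a t))"

definition bumps_used :: "(real \<Rightarrow> real) set \<Rightarrow> (real \<Rightarrow> real) set" where
  "bumps_used X = {a. used_in a X}"

definition geom_proper :: "(real \<Rightarrow> real) set \<Rightarrow> bool" where
  "geom_proper X \<longleftrightarrow>
     (\<forall>t. \<forall>f\<in>X. \<forall>g\<in>X. left_tp f t \<and> left_tp g t \<longrightarrow> f = g) \<and>
     (\<forall>t. \<forall>f\<in>X. \<forall>g\<in>X. right_tp f t \<and> right_tp g t \<longrightarrow> f = g)"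

text \<open>Feet of a positive bump a with orbital (x,y) = (Inf (supt a), Sup (supt a)) and marker m a.\<close>
definition src :: "((real \<Rightarrow> real) \<Rightarrow> real) \<Rightarrow> (real \<Rightarrow> real) \<Rightarrow> real set" where
  "src m a = {Inf (supt a)<..<m a}"

definition dest :: "((real \<Rightarrow> real) \<Rightarrow> real) \<Rightarrow> (real \<Rightarrow> real) \<Rightarrow> real set" where
  "dest m a = {a (m a)..<Sup (supt a)}"

definition fast_marking :: "(real \<Rightarrow> real) set \<Rightarrow> ((real \<Rightarrow> real) \<Rightarrow> real) \<Rightarrow> bool" where
  "fast_marking A m \<longleftrightarrow> (\<forall>a\<in>A. m a \<in> supt a) \<and>
     (\<forall>a\<in>A. \<forall>b\<in>A. src m a \<inter> dest m b = {} \<and>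
        (a \<noteq> b \<longrightarrow> src m a \<inter> src m b = {} \<and> dest m a \<inter> dest m b = {}))"

definition geom_fast_bumps :: "(real \<Rightarrow> real) set \<Rightarrow> bool" where
  "geom_fast_bumps A \<longleftrightarrow> (\<forall>a\<in>A. pos_bump a) \<and> geom_proper A \<and> (\<exists>m. fast_marking A m)"

definition geom_fast :: "(real \<Rightarrow> real) set \<Rightarrow> bool" where
  "geom_fast X \<longleftrightarrow> geom_proper X \<and> geom_fast_bumps (bumps_used X)"

definition vertices :: "(real \<Rightarrow> real) set \<Rightarrow> ((real \<Rightarrow> real) \<Rightarrow> real) \<Rightarrow> real set set" where
  "vertices X m = (\<Union>a\<in>bumps_used X. {src m a, dest m a})"

text \<open>Source and destination foot of a signed bump b (positive: b itself; negative: b = a^-1).\<close>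
definition sfoot :: "((real \<Rightarrow> real) \<Rightarrow> real) \<Rightarrow> (real \<Rightarrow> real) \<Rightarrow> real set" where
  "sfoot m b = (if (\<forall>t\<in>supt b. b t > t) then src m b else dest m (inv b))"

definition tfoot :: "((real \<Rightarrow> real) \<Rightarrow> real) \<Rightarrow> (real \<Rightarrow> real) \<Rightarrow> real set" where
  "tfoot m b = (if (\<forall>t\<in>supt b. b t > t) then dest m b else src m (inv b))"

definition edges :: "(real \<Rightarrow> real) set \<Rightarrow> ((real \<Rightarrow> real) \<Rightarrow> real)
    \<Rightarrow> (real set \<times> real set \<times> (real \<Rightarrow> real)) set" where
  "edges X m = {(sfoot m b, tfoot m b, f) | b f. f \<in> X \<and> signed_bump b f}"

definition foot_less :: "real set \<Rightarrow> real set \<Rightarrow> bool" where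
  "foot_less U W \<longleftrightarrow> (\<forall>u\<in>U. \<forall>w\<in>W. u < w)"

definition diagram_iso :: "(real \<Rightarrow> real) set \<Rightarrow> ((real \<Rightarrow> real) \<Rightarrow> real) \<Rightarrow>
    (real \<Rightarrow> real) set \<Rightarrow> ((real \<Rightarrow> real) \<Rightarrow> real) \<Rightarrow>
    (real set \<Rightarrow> real set) \<Rightarrow> ((real \<Rightarrow> real) \<Rightarrow> (real \<Rightarrow> real)) \<Rightarrow> bool" where
  "diagram_iso X mX Y mY \<psi> \<tau> \<longleftrightarrow>
     bij_betw \<psi> (vertices X mX) (vertices Y mY) \<and>
     (\<forall>U\<in>vertices X mX. \<forall>W\<in>vertices X mX. foot_less U W \<longleftrightarrow> foot_less (\<psi> U) (\<psi> W)) \<and>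
     bij_betw \<tau> X Y \<and>
     (\<forall>U\<in>vertices X mX. \<forall>W\<in>vertices X mX. \<forall>f\<in>X.
        (U, W, f) \<in> edges X mX \<longleftrightarrow> (\<psi> U, \<psi> W, \<tau> f) \<in> edges Y mY)"

inductive_set gen :: "(real \<Rightarrow> real) set \<Rightarrow> (real \<Rightarrow> real) set" for X where
  gen_id: "id \<in> gen X"
| gen_base: "f \<in> X \<Longrightarrow> f \<in> gen X"
| gen_mult: "f \<in> gen X \<Longrightarrow> g \<in> gen X \<Longrightarrow> g \<circ> f \<in> gen X"
| gen_inv: "f \<in> gen X \<Longrightarrow> inv f \<in> gen X"

definition group_iso_on :: "(real \<Rightarrow> real) set \<Rightarrow> (real \<Rightarrow> real) set \<Rightarrow>
    ((real \<Rightarrow> real) \<Rightarrow> (real \<Rightarrow> real)) \<Rightarrow> bool" where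
  "group_iso_on G H \<phi> \<longleftrightarrow> bij_betw \<phi> G H \<and> (\<forall>f\<in>G. \<forall>g\<in>G. \<phi> (g \<circ> f) = \<phi> g \<circ> \<phi> f)"

text \<open>Canonical marking data: only the markers of initial bumps are needed (t_k = s_k there).\<close>
definition isolated :: "(real \<Rightarrow> real) set \<Rightarrow> (real \<Rightarrow> real) \<Rightarrow> bool" where
  "isolated A a \<longleftrightarrow> supt a \<inter> trans_pts A = {}"

definition s_pt :: "(real \<Rightarrow> real) set \<Rightarrow> (real \<Rightarrow> real) \<Rightarrow> real" where
  "s_pt A a = (if isolated A a then (Inf (supt a) + Sup (supt a)) / 2
               else Min (supt a \<inter> trans_pts A))"

definition initial :: "(real \<Rightarrow> real) set \<Rightarrow> (real \<Rightarrow> real) \<Rightarrow> bool" where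
  "initial A a \<longleftrightarrow> isolated A a \<or> \<not> (\<exists>b\<in>A. right_tp b (s_pt A a))"

definition M0 :: "(real \<Rightarrow> real) set \<Rightarrow> real set" where
  "M0 X = {s_pt (bumps_used X) a | a. a \<in> bumps_used X \<and> initial (bumps_used X) a}"

definition Mgen :: "(real \<Rightarrow> real) set \<Rightarrow> real set" where
  "Mgen X = {g t | t g. t \<in> M0 X \<and> g \<in> gen X}"

end

theory Submission
  imports Defs
begin

text \<open>
  Every element of \<open>X\<close> acts near a point either trivially or as one signed bump, so a point of
  \<open>M\<langle>X\<rangle>\<close> is reached from an initial marker by a stack of signed bumps ("letters") each of which moves
  it and none of which cancels its predecessor. By ping-pong the point then lies in the destination
  foot of the last letter. Hence whether a further letter moves, extends or cancels the stack, and
  how two stacks compare as points, depends only on the order of the feet, that is, on the dynamical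
  diagram; this gives the equivariant order isomorphism \<open>\<theta>\<close>.

  The group isomorphism follows once \<open>\<langle>X\<rangle>\<close> is known to act faithfully on \<open>M\<langle>X\<rangle>\<close>. Given \<open>g\<close> fixing
  \<open>M\<langle>X\<rangle>\<close> and any point \<open>t\<close>, trace \<open>t\<close> back through the feet containing it, until it leaves all feet
  or more steps were made than \<open>g\<close> has letters. Replacing the ancestor by a suitable marker, which
  lies in \<open>M\<langle>X\<rangle>\<close>, or by the right end of an orbital, which is a limit of points of \<open>M\<langle>X\<rangle>\<close>, does not
  change what \<open>g\<close> does to the stack, so \<open>g\<close> fixes \<open>t\<close>.
\<close>

section \<open>Homeomorphisms and bumps\<close>

text \<open>Words in \<open>X\<close> are poor coordinates, since different words may reach the same
  point. Reduced stacks are good ones: the feet are disjoint, so a point determines the top letter,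
  and peeling recovers the whole stack as soon as the base point lies outside all feet
  (\<open>ev_inject\<close>). This is why only initial markers serve as base points. The canonical
  marking makes every other marker the left end \<open>d (m d)\<close> of the destination foot of a
  bump \<open>d\<close> further to the left, hence itself the value of a stack over an initial
  marker. The marking that comes with a diagram need not behave like this and is exchanged for a
  canonical one; the order of the feet does not depend on the marking. The obstacle to faithfulness
  is that tracing an arbitrary point back need not end. A generator or its inverse removes at most
  one letter, so a product of \<open>k\<close> of them cannot reach below a stack of
  \<open>k + 1\<close> letters, and whatever lies underneath may be exchanged.\<close>

lemma homeo_plus_iff:
  "homeo_plus f \<longleftrightarrow> strict_mono f \<and> surj f \<and> (\<forall>x. x \<notin> {0..1} \<longrightarrow> f x = x)"
proof
  assume f: "homeo_plus f"
  then obtain g where g: "homeomorphism {0..1} {0..1} f g"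
    and mono: "mono_on {0..1} f" and out: "\<And>x. x \<notin> {0..1} \<Longrightarrow> f x = x"
    by (auto simp: homeo_plus_def)
  have img: "f ` {0..1} = {0..1}" and gf: "\<And>x. x \<in> {0..1} \<Longrightarrow> g (f x) = x"
    using g by (auto simp: homeomorphism_def)
  have inside: "f x \<in> {0..1}" if "x \<in> {0..1}" for x using img that by blast
  have "f x < f y" if "x < y" for x y
  proof (cases "x \<in> {0..1} \<and> y \<in> {0..1}")
    case True
    then have "f x \<le> f y" using mono that by (auto simp: mono_on_def)
    moreover have "f x \<noteq> f y" using gf True that by (metis less_irrefl)
    ultimately show ?thesis by simp
  next
    case False
    then show ?thesis
      using inside[of x] inside[of y] out[of x] out[of y] that
      by (cases "x \<in> {0..1}"; cases "y \<in> {0..1}") auto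
  qed
  then have "strict_mono f" by (simp add: strict_mono_def)
  moreover have "y \<in> range f" for y
    using img out by (cases "y \<in> {0..1}") (blast, metis rangeI)
  then have "surj f" by blast
  ultimately show "strict_mono f \<and> surj f \<and> (\<forall>x. x \<notin> {0..1} \<longrightarrow> f x = x)"
    using out by blast
next
  assume f: "strict_mono f \<and> surj f \<and> (\<forall>x. x \<notin> {0..1} \<longrightarrow> f x = x)"
  then have bij: "bij f" by (simp add: bij_def strict_mono_imp_inj_on)
  have inside: "f x \<in> {0..1} \<longleftrightarrow> x \<in> {0..1}" for x
  proof (cases "x \<in> {0..1}")
    case True
    have "f x \<in> {0..1}"
    proof (rule ccontr)
      assume "f x \<notin> {0..1}"
      moreover from this have "f (f x) = f x" using f by blast
      then have "f x = x" using bij by (metis bij_def injD)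
      ultimately show False using True by simp
    qed
    with True show ?thesis by simp
  qed (use f in auto)
  have img: "f ` {0..1} = {0..1}"
    using bij inside by (auto simp: image_iff bij_def) (metis atLeastAtMost_iff surjD)
  have mono_inv: "mono (inv f)"
  proof (rule monoI)
    fix x y :: real
    assume "x \<le> y"
    then have "f (inv f x) \<le> f (inv f y)" using f by (simp add: surj_f_inv_f)
    then show "inv f x \<le> inv f y" using f by (simp add: strict_mono_less_eq)
  qed
  have "continuous_on UNIV f" and "continuous_on UNIV (inv f)"
    using f bij mono_inv
    by (auto intro!: continuous_onI_mono simp: strict_mono_less_eq bij_is_surj bij_imp_bij_inv monoD)
  moreover have "inv f ` {0..1} = {0..1}"
    using img bij by (metis bij_is_inj inv_f_f image_inv_f_f)
  ultimately have "homeomorphism {0..1} {0..1} f (inv f)"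
    using img bij unfolding homeomorphism_def
    by (auto simp: bij_is_inj bij_is_surj surj_f_inv_f intro: continuous_on_subset)
  then show "homeo_plus f"
    using f by (auto simp: homeo_plus_def mono_on_def strict_mono_less_eq)
qed

lemma homeo_plus_strict_mono: "homeo_plus f \<Longrightarrow> strict_mono f"
  and homeo_plus_outside: "homeo_plus f \<Longrightarrow> x \<notin> {0..1} \<Longrightarrow> f x = x"
  by (auto simp: homeo_plus_iff)

lemma homeo_plus_bij: "homeo_plus f \<Longrightarrow> bij f"
  by (simp add: homeo_plus_iff bij_def strict_mono_imp_inj_on)

lemma homeo_plus_id: "homeo_plus id"
  by (simp add: homeo_plus_iff strict_mono_def)

lemma homeo_plus_comp: "homeo_plus f \<Longrightarrow> homeo_plus g \<Longrightarrow> homeo_plus (g \<circ> f)"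
  using comp_surj[of f g] by (auto simp: homeo_plus_iff strict_mono_def comp_def)

lemma homeo_plus_inv:
  assumes "homeo_plus f"
  shows "homeo_plus (inv f)"
proof -
  have bij: "bij f" and sm: "strict_mono f"
    using assms by (auto simp: homeo_plus_bij homeo_plus_strict_mono)
  have f_inv: "f (inv f x) = x" for x using bij by (simp add: bij_is_surj surj_f_inv_f)
  have "inv f x < inv f y" if "x < y" for x y
    using that strict_mono_less[OF sm, of "inv f x" "inv f y"] by (simp add: f_inv)
  moreover have "inv f x = x" if "x \<notin> {0..1}" for x
    using homeo_plus_outside[OF assms that] bij by (metis bij_inv_eq_iff)
  ultimately show ?thesis
    using bij by (simp add: homeo_plus_iff strict_mono_def bij_is_surj bij_imp_bij_inv)
qed

lemma homeo_plus_continuous: "homeo_plus f \<Longrightarrow> continuous_on S f"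
  by (rule continuous_on_subset[OF _ subset_UNIV], rule continuous_onI_mono)
    (auto simp: homeo_plus_iff strict_mono_less_eq)

lemma homeo_plus_supt: "homeo_plus f \<Longrightarrow> supt f = {t. f t \<noteq> t}"
  by (auto simp: supt_def dest: homeo_plus_outside[of f])

lemma open_supt: "homeo_plus f \<Longrightarrow> open (supt f)"
  by (simp add: homeo_plus_supt open_Collect_neq homeo_plus_continuous)

lemma supt_inv: "homeo_plus f \<Longrightarrow> supt (inv f) = supt f"
  using homeo_plus_bij[of f]
  by (auto simp: homeo_plus_supt homeo_plus_inv bij_inv_eq_iff) (metis bij_inv_eq_iff)+

lemma supt_image_iff: "homeo_plus f \<Longrightarrow> f t \<in> supt f \<longleftrightarrow> t \<in> supt f"
  by (simp add: homeo_plus_supt inj_eq[OF bij_is_inj[OF homeo_plus_bij]])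

lemma open_interval_of_connected:
  fixes S :: "real set"
  assumes "open S" "connected S" "S \<noteq> {}" "bounded S"
  obtains x y where "x < y" "S = {x<..<y}"
proof -
  have bdd: "bdd_below S" "bdd_above S"
    using assms(4) bounded_imp_bdd_below bounded_imp_bdd_above by auto
  have ivl: "v \<in> S" if "u \<in> S" "w \<in> S" "u \<le> v" "v \<le> w" for u v w
    using assms(2) that by (meson connected_iff_interval)
  have "S = {Inf S<..<Sup S}"
  proof (intro equalityI subsetI)
    fix t assume t: "t \<in> S"
    then obtain e where e: "e > 0" "ball t e \<subseteq> S" using assms(1) openE by blast
    then have "t - e/2 \<in> S" "t + e/2 \<in> S" by (auto simp: dist_real_def subset_iff)
    then have "Inf S \<le> t - e/2" "t + e/2 \<le> Sup S"
      using bdd by (auto intro: cInf_lower cSup_upper)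
    then show "t \<in> {Inf S<..<Sup S}" using e by auto
  next
    fix t assume "t \<in> {Inf S<..<Sup S}"
    then obtain u w where "u \<in> S" "u < t" "w \<in> S" "t < w"
      using cInf_less_iff[OF assms(3) bdd(1)] less_cSup_iff[OF assms(3) bdd(2)] by auto
    then show "t \<in> S" by (meson ivl less_imp_le)
  qed
  moreover from this have "Inf S < Sup S" using assms(3) by auto
  ultimately show thesis using that by blast
qed

section \<open>Bumps: orbitals as open intervals, signs, restriction to one orbital\<close>

abbreviation lo :: "(real \<Rightarrow> real) \<Rightarrow> real" where "lo a \<equiv> Inf (supt a)"
abbreviation hi :: "(real \<Rightarrow> real) \<Rightarrow> real" where "hi a \<equiv> Sup (supt a)"

lemma bounded_supt: "bounded (supt f)"
  by (rule bounded_subset[of "{0..1}"]) (auto simp: supt_def)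

lemma bump_iff_connected: "bump f \<longleftrightarrow> homeo_plus f \<and> connected (supt f) \<and> supt f \<noteq> {}"
proof -
  have "(\<exists>!C. C \<in> components S) \<longleftrightarrow> connected S \<and> S \<noteq> {}" for S :: "real set"
  proof
    assume "\<exists>!C. C \<in> components S"
    then obtain C where "components S = {C}" by auto
    then have "C = S" using Union_components[of S] by simp
    then show "connected S \<and> S \<noteq> {}"
      using \<open>components S = {C}\<close> in_components_connected in_components_nonempty by blast
  next
    assume "connected S \<and> S \<noteq> {}"
    then have "components S = {S}" using components_eq_sing_iff by blast
    then show "\<exists>!C. C \<in> components S" by simp
  qed
  then show ?thesis by (simp add: bump_def orbitals_def)
qed

lemma bump_supt: "bump b \<Longrightarrow> supt b = {lo b<..<hi b}"
  and bump_lo_less_hi: "bump b \<Longrightarrow> lo b < hi b"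
proof -
  assume "bump b"
  then obtain x y where "x < y" "supt b = {x<..<y}"
    using open_interval_of_connected[of "supt b"] open_supt bounded_supt
    by (auto simp: bump_iff_connected)
  then show "supt b = {lo b<..<hi b}" "lo b < hi b" by auto
qed

lemma bump_inv: "bump b \<Longrightarrow> bump (inv b)"
  by (simp add: bump_iff_connected homeo_plus_inv supt_inv)

lemma moved_up_iff_inv_down:
  assumes "homeo_plus f"
  shows "(\<forall>t\<in>supt f. inv f t < t) \<longleftrightarrow> (\<forall>t\<in>supt f. t < f t)"
proof -
  have bij: "bij f" by (simp add: assms homeo_plus_bij)
  have "inv f (f t) = t" "f (inv f t) = t" for t
    using bij by (simp_all add: bij_is_inj bij_is_surj surj_f_inv_f)
  moreover have "inv f t \<in> supt f \<longleftrightarrow> t \<in> supt f" for t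
    by (metis assms calculation(2) supt_image_iff)
  ultimately show ?thesis using supt_image_iff[OF assms] by metis
qed

text \<open>The displacement \<open>b t - t\<close> is continuous and has no zero on the connected
  support, so its sign is constant there.\<close>

lemma bump_cases:
  assumes "bump b"
  shows "pos_bump b \<or> pos_bump (inv b)"
proof -
  have h: "homeo_plus b" and conn: "connected (supt b)" using assms by (auto simp: bump_iff_connected)
  let ?d = "\<lambda>t. b t - t"
  have "connected (?d ` supt b)"
    by (intro connected_continuous_image conn continuous_intros homeo_plus_continuous h)
  moreover have "0 \<notin> ?d ` supt b" using h by (auto simp: homeo_plus_supt)
  ultimately have one_sign: "\<not> (u < 0 \<and> 0 < w)" if "u \<in> ?d ` supt b" "w \<in> ?d ` supt b" for u w
    using that unfolding connected_iff_interval by (meson less_imp_le)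
  have "(\<forall>t\<in>supt b. b t > t) \<or> (\<forall>t\<in>supt b. b t < t)"
  proof (rule ccontr)
    assume "\<not> ?thesis"
    then obtain s t where st: "s \<in> supt b" "\<not> b s > s" "t \<in> supt b" "\<not> b t < t" by blast
    moreover from this have "b s \<noteq> s" "b t \<noteq> t" using h by (auto simp: homeo_plus_supt)
    ultimately show False using one_sign[of "?d s" "?d t"] by auto
  qed
  moreover have "inv (inv b) = b" by (simp add: h homeo_plus_bij inv_inv_eq)
  then have "(\<forall>t\<in>supt b. b t < t) \<longleftrightarrow> (\<forall>t\<in>supt b. t < inv b t)"
    using moved_up_iff_inv_down[OF homeo_plus_inv[OF h]] by (simp add: supt_inv h)
  ultimately show ?thesis
    using assms by (auto simp: pos_bump_def bump_inv supt_inv h)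
qed

text \<open>The bump is \<open>f\<close> cut off outside the connected component of
  \<open>supt f\<close> around \<open>t\<close>. The ends of that component are fixed by
  \<open>f\<close>, so \<open>f\<close> preserves it and the cut-off is again a
  homeomorphism.\<close>

lemma signed_bump_at:
  assumes f: "homeo_plus f" and t: "f t \<noteq> t"
  obtains b where "signed_bump b f" "t \<in> supt b"
proof -
  define C where "C = connected_component_set (supt f) t"
  have tS: "t \<in> supt f" using f t by (simp add: homeo_plus_supt)
  then have tC: "t \<in> C" by (simp add: C_def)
  have "C \<subseteq> supt f" by (simp add: C_def connected_component_subset)
  moreover have "open C" by (simp add: C_def open_connected_component open_supt f)
  moreover have "connected C" by (simp add: C_def)
  ultimately obtain x y where xy: "x < y" "C = {x<..<y}"
    using open_interval_of_connected[of C] tC bounded_subset[OF bounded_supt] by blast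
  have maximal: "D \<subseteq> C" if "connected D" "D \<subseteq> supt f" "D \<inter> C \<noteq> {}" for D
    using that unfolding C_def
    by (metis Int_emptyI connected_component_eq connected_component_maximal mem_Collect_eq)
  \<comment> \<open>An endpoint moved by \<open>f\<close> could be added to the component, giving a
    larger connected subset of the support.\<close>
  have "x \<notin> supt f"
  proof
    assume "x \<in> supt f"
    then have "{x..<y} \<subseteq> supt f" using \<open>C \<subseteq> supt f\<close> xy by (auto simp: order_less_le)
    moreover have "t \<in> {x..<y} \<inter> C" using tC xy by auto
    ultimately have "{x..<y} \<subseteq> C" by (intro maximal) auto
    then show False using xy by auto
  qed
  moreover have "y \<notin> supt f"
  proof
    assume "y \<in> supt f"
    then have "{x<..y} \<subseteq> supt f" using \<open>C \<subseteq> supt f\<close> xy by (auto simp: order_less_le)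
    moreover have "t \<in> {x<..y} \<inter> C" using tC xy by auto
    ultimately have "{x<..y} \<subseteq> C" by (intro maximal) auto
    then show False using xy by auto
  qed
  ultimately have fix_ends: "f x = x" "f y = y" using f by (auto simp: homeo_plus_supt)
  have sm: "strict_mono f" by (simp add: f homeo_plus_strict_mono)
  have CC: "f s \<in> C \<longleftrightarrow> s \<in> C" for s
    using strict_mono_less[OF sm, of x s] strict_mono_less[OF sm, of s y] fix_ends xy by simp
  define b where "b s = (if s \<in> C then f s else s)" for s
  have "b u < b v" if "u < v" for u v
    using that CC[of u] CC[of v] xy strict_mono_less[OF sm, of u v] by (auto simp: b_def)
  then have "strict_mono b" by (simp add: strict_mono_def)
  moreover have "v \<in> range b" for v
  proof (cases "v \<in> C")
    case True
    obtain u where "f u = v" using f by (metis homeo_plus_iff surjD)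
    then show ?thesis using True CC by (auto simp: b_def image_iff)
  qed (auto simp: b_def image_iff)
  then have "surj b" by blast
  ultimately have hb: "homeo_plus b" using f by (auto simp: homeo_plus_iff b_def)
  have "supt b = C" using \<open>C \<subseteq> supt f\<close> f by (auto simp: homeo_plus_supt hb b_def)
  then have "bump b" using hb \<open>connected C\<close> tC by (auto simp: bump_iff_connected)
  then show thesis using that[of b] \<open>supt b = C\<close> tC by (simp add: signed_bump_def b_def)
qed

section \<open>Letters, feet and ping-pong\<close>

lemma pos_bumpD:
  assumes "pos_bump a"
  shows "homeo_plus a" "bump a" "strict_mono a" "bij a" "supt a = {lo a<..<hi a}" "lo a < hi a"
    and "a (lo a) = lo a" "a (hi a) = hi a" "lo a < t \<Longrightarrow> t < hi a \<Longrightarrow> t < a t"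
proof -
  show h: "homeo_plus a" and b: "bump a" using assms by (auto simp: pos_bump_def bump_def)
  then show "strict_mono a" "bij a" by (auto simp: homeo_plus_strict_mono homeo_plus_bij)
  show s: "supt a = {lo a<..<hi a}" "lo a < hi a"
    using b by (rule bump_supt bump_lo_less_hi)+
  have "lo a \<notin> supt a" "hi a \<notin> supt a" by (subst s, simp)+
  then show "a (lo a) = lo a" "a (hi a) = hi a" using h by (auto simp: homeo_plus_supt)
  assume "lo a < t" "t < hi a"
  then have "t \<in> supt a" by (subst s) simp
  then show "t < a t" using assms by (simp add: pos_bump_def)
qed

lemma mem_supt_iff: "pos_bump a \<Longrightarrow> t \<in> supt a \<longleftrightarrow> lo a < t \<and> t < hi a"
  by (subst pos_bumpD(5)) auto

lemma left_tp_iff: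
  assumes "pos_bump a"
  shows "left_tp a t \<longleftrightarrow> t = lo a"
proof
  assume t: "left_tp a t"
  have "\<not> hi a \<le> t" using t by (auto simp: left_tp_def mem_supt_iff[OF assms] dest!: spec[of _ 1])
  moreover have "\<not> t < lo a"
    using t by (auto simp: left_tp_def mem_supt_iff[OF assms] dest!: spec[of _ "lo a - t"])
  moreover have "\<not> (lo a < t \<and> t < hi a)" using t by (simp add: left_tp_def mem_supt_iff[OF assms])
  ultimately show "t = lo a" by linarith
next
  have mem: "(lo a + min (hi a) (lo a + \<epsilon>)) / 2 \<in> {lo a<..<lo a + \<epsilon>} \<inter> supt a" if "\<epsilon> > 0" for \<epsilon>
    using pos_bumpD(6)[OF assms] that by (auto simp: mem_supt_iff[OF assms] min_def field_simps)
  have "lo a \<in> {0..1}"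
  proof (rule ccontr)
    assume out: "lo a \<notin> {0..1}"
    have s: "supt a \<subseteq> {0..1}" by (auto simp: supt_def)
    then consider "lo a < 0" | "lo a > 1" using out by force
    then show False
    proof cases
      case 1 then show False using mem[of "- lo a"] s by force
    next
      case 2 then show False using mem[of 1] s by force
    qed
  qed
  moreover have "{lo a<..<lo a + \<epsilon>} \<inter> supt a \<noteq> {}" if "\<epsilon> > 0" for \<epsilon> using mem[OF that] by blast
  moreover have "lo a \<notin> supt a" by (simp add: mem_supt_iff[OF assms])
  moreover assume "t = lo a"
  ultimately show "left_tp a t" by (simp add: left_tp_def)
qed

lemma right_tp_iff:
  assumes "pos_bump a"
  shows "right_tp a t \<longleftrightarrow> t = hi a"
proof
  assume t: "right_tp a t"
  have "\<not> t \<le> lo a" using t by (auto simp: right_tp_def mem_supt_iff[OF assms] dest!: spec[of _ 1])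
  moreover have "\<not> hi a < t"
    using t by (auto simp: right_tp_def mem_supt_iff[OF assms] dest!: spec[of _ "t - hi a"])
  moreover have "\<not> (lo a < t \<and> t < hi a)" using t by (simp add: right_tp_def mem_supt_iff[OF assms])
  ultimately show "t = hi a" by linarith
next
  have mem: "(hi a + max (lo a) (hi a - \<epsilon>)) / 2 \<in> {hi a - \<epsilon><..<hi a} \<inter> supt a" if "\<epsilon> > 0" for \<epsilon>
    using pos_bumpD(6)[OF assms] that by (auto simp: mem_supt_iff[OF assms] max_def field_simps)
  have "hi a \<in> {0..1}"
  proof (rule ccontr)
    assume out: "hi a \<notin> {0..1}"
    have s: "supt a \<subseteq> {0..1}" by (auto simp: supt_def)
    then consider "hi a < 0" | "hi a > 1" using out by force
    then show False
    proof cases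
      case 1 then show False using mem[of 1] s by force
    next
      case 2 then show False using mem[of "hi a - 1"] s by force
    qed
  qed
  moreover have "{hi a - \<epsilon><..<hi a} \<inter> supt a \<noteq> {}" if "\<epsilon> > 0" for \<epsilon> using mem[OF that] by blast
  moreover have "hi a \<notin> supt a" by (simp add: mem_supt_iff[OF assms])
  moreover assume "t = hi a"
  ultimately show "right_tp a t" by (simp add: right_tp_def)
qed

lemma trans_pts_bumps:
  "\<forall>a\<in>A. pos_bump a \<Longrightarrow> trans_pts A = lo ` A \<union> hi ` A"
  by (auto simp: trans_pts_def left_tp_iff right_tp_iff)

text \<open>A positive bump together with its exponent (\<open>True\<close> for the bump,
  \<open>False\<close> for its inverse). Thus a letter names exactly one foot, and inverting it only
  flips the boolean.\<close>

type_synonym letter = "(real \<Rightarrow> real) \<times> bool"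

definition lact :: "letter \<Rightarrow> real \<Rightarrow> real" where
  "lact l = (if snd l then fst l else inv (fst l))"

definition linv :: "letter \<Rightarrow> letter" where
  "linv l = (fst l, \<not> snd l)"

text \<open>The foot of a letter is its destination, so its source is the foot of the inverse letter.\<close>
definition foot :: "((real \<Rightarrow> real) \<Rightarrow> real) \<Rightarrow> letter \<Rightarrow> real set" where
  "foot m l = (if snd l then dest m (fst l) else src m (fst l))"

lemma fst_linv [simp]: "fst (linv l) = fst l"
  and linv_linv [simp]: "linv (linv l) = l"
  and linv_neq [simp]: "linv l \<noteq> l" "l \<noteq> linv l"
  by (auto simp: linv_def prod_eq_iff)

lemma lact_homeo: "pos_bump (fst l) \<Longrightarrow> homeo_plus (lact l)"
  by (simp add: lact_def pos_bumpD(1) homeo_plus_inv)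

lemma lact_linv:
  assumes "pos_bump (fst l)"
  shows "lact (linv l) (lact l t) = t"
  using pos_bumpD(4)[OF assms]
  by (simp add: lact_def linv_def bij_is_inj bij_is_surj surj_f_inv_f)

lemma supt_lact: "pos_bump (fst l) \<Longrightarrow> supt (lact l) = supt (fst l)"
  by (simp add: lact_def supt_inv pos_bumpD(1))

lemma lact_supt_iff: "pos_bump (fst l) \<Longrightarrow> lact l t \<in> supt (fst l) \<longleftrightarrow> t \<in> supt (fst l)"
  using supt_image_iff[OF lact_homeo, of l t] by (simp add: supt_lact)

lemma lact_less_iff: "pos_bump (fst l) \<Longrightarrow> lact l s < lact l t \<longleftrightarrow> s < t"
  using strict_mono_less[OF homeo_plus_strict_mono[OF lact_homeo]] .

lemma lact_outside: "pos_bump (fst l) \<Longrightarrow> t \<notin> supt (fst l) \<Longrightarrow> lact l t = t"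
  using homeo_plus_supt[OF lact_homeo, of l] by (auto simp: supt_lact)

primrec ev :: "real \<Rightarrow> letter list \<Rightarrow> real" where
  "ev r [] = r"
| "ev r (l # u) = lact l (ev r u)"

lemma ev_append: "ev r (u @ v) = ev (ev r v) u"
  by (induction u) auto

text \<open>Stacks of letters, the last letter applied on top: the point enters the support of each
  letter outside of its source, which makes it land in the foot of that letter.\<close>
primrec reduced_stack :: "(real \<Rightarrow> real) set \<Rightarrow> ((real \<Rightarrow> real) \<Rightarrow> real) \<Rightarrow> real \<Rightarrow> letter list \<Rightarrow> bool" where
  "reduced_stack A m r [] \<longleftrightarrow> True"
| "reduced_stack A m r (l # u) \<longleftrightarrow> reduced_stack A m r u \<and> fst l \<in> A \<and>
     ev r u \<in> supt (fst l) \<and> ev r u \<notin> foot m (linv l)"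

lemma reduced_append:
  "reduced_stack A m r (u @ v) \<longleftrightarrow> reduced_stack A m r v \<and> reduced_stack A m (ev r v) u"
  by (induction u) (auto simp: ev_append)

lemma reduced_letters: "reduced_stack A m r u \<Longrightarrow> l \<in> set u \<Longrightarrow> fst l \<in> A"
  by (induction u) auto

section \<open>Disjoint feet: ping-pong, order of the feet, uniqueness of stacks\<close>

locale pingpong =
  fixes A :: "(real \<Rightarrow> real) set" and m :: "(real \<Rightarrow> real) \<Rightarrow> real"
  assumes pos: "a \<in> A \<Longrightarrow> pos_bump a"
    and fast: "fast_marking A m"
begin

lemma marker:
  assumes "a \<in> A"
  shows "lo a < m a" "m a < a (m a)" "a (m a) < hi a" "m a < hi a" "lo a < a (m a)"
proof -
  have "m a \<in> supt a" using fast assms by (simp add: fast_marking_def)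
  moreover from this have "a (m a) \<in> supt a"
    using pos[OF assms] by (simp add: pos_bumpD(1) supt_image_iff)
  ultimately show "lo a < m a" "m a < a (m a)" "a (m a) < hi a" "m a < hi a" "lo a < a (m a)"
    using pos[OF assms] by (auto simp: mem_supt_iff pos_bumpD(9))
qed

lemma mem_foot_iff:
  "t \<in> foot m l \<longleftrightarrow> (if snd l then fst l (m (fst l)) \<le> t \<and> t < hi (fst l) else lo (fst l) < t \<and> t < m (fst l))"
  by (simp add: foot_def src_def dest_def)

lemma foot_disjoint:
  assumes "fst k \<in> A" "fst l \<in> A" "k \<noteq> l"
  shows "foot m k \<inter> foot m l = {}"
proof -
  obtain a s b s' where kl: "k = (a, s)" "l = (b, s')" by (cases k; cases l)
  then have ab: "a \<in> A" "b \<in> A" using assms by auto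
  then have "src m a \<inter> dest m b = {}" "src m b \<inter> dest m a = {}"
    and "a \<noteq> b \<longrightarrow> src m a \<inter> src m b = {} \<and> dest m a \<inter> dest m b = {}"
    using fast unfolding fast_marking_def by blast+
  then show ?thesis using assms(3) unfolding kl foot_def by (cases s; cases s') auto
qed

lemma foot_unique: "fst k \<in> A \<Longrightarrow> fst l \<in> A \<Longrightarrow> t \<in> foot m k \<Longrightarrow> t \<in> foot m l \<Longrightarrow> k = l"
  using foot_disjoint by blast

lemma foot_nonempty: "fst l \<in> A \<Longrightarrow> \<exists>t. t \<in> foot m l"
  using marker[of "fst l"] dense[of "lo (fst l)" "m (fst l)"]
  by (auto simp: mem_foot_iff)

lemma foot_inject: "fst k \<in> A \<Longrightarrow> fst l \<in> A \<Longrightarrow> foot m k = foot m l \<longleftrightarrow> k = l"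
  using foot_unique foot_nonempty by metis

lemma foot_convex: "s \<in> foot m l \<Longrightarrow> u \<in> foot m l \<Longrightarrow> s \<le> t \<Longrightarrow> t \<le> u \<Longrightarrow> t \<in> foot m l"
  by (auto simp: mem_foot_iff split: if_splits)

lemma foot_subset_supt: "fst l \<in> A \<Longrightarrow> foot m l \<subseteq> supt (fst l)"
  using marker[of "fst l"] by (auto simp: mem_foot_iff mem_supt_iff pos split: if_splits)

text \<open>This is where the half-open shape of the feet enters: for a positive letter, being
  outside the source means \<open>m a \<le> t\<close>, hence \<open>a (m a) \<le> a t\<close>; for
  an inverse letter it means \<open>t < a (m a)\<close>, hence \<open>inv a t < m a\<close>.\<close>

lemma ping:
  assumes "fst l \<in> A" "t \<in> supt (fst l)" "t \<notin> foot m (linv l)"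
  shows "lact l t \<in> foot m l"
proof -
  obtain a s where l: "l = (a, s)" by (cases l)
  have a: "pos_bump a" "a \<in> A" using assms pos by (auto simp: l)
  have sup: "lo a < lact l t" "lact l t < hi a"
    using assms a lact_supt_iff[of l t] by (auto simp: l mem_supt_iff)
  show ?thesis
  proof (cases s)
    case True
    then have "m a \<le> t" using assms a by (auto simp: l mem_foot_iff linv_def mem_supt_iff)
    then have "a (m a) \<le> lact l t"
      using True by (simp add: l lact_def strict_mono_less_eq pos_bumpD(3)[OF a(1)])
    then show ?thesis using sup True by (simp add: l mem_foot_iff)
  next
    case False
    then have "t < a (m a)" using assms a by (auto simp: l mem_foot_iff linv_def mem_supt_iff)
    moreover have "a (lact l t) = t"
      using False pos_bumpD(4)[OF a(1)] by (simp add: l lact_def bij_is_surj surj_f_inv_f)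
    ultimately have "lact l t < m a"
      using strict_mono_less[OF pos_bumpD(3)[OF a(1)], of "lact l t" "m a"] by simp
    then show ?thesis using sup False by (simp add: l mem_foot_iff)
  qed
qed

text \<open>Converse of \<open>ping\<close>: undoing a letter on a point of its foot gives a point
  to which that letter may be applied in a reduced stack. This allows points to be traced
  back.\<close>

lemma pong:
  assumes "fst l \<in> A" "t \<in> foot m l"
  shows "lact (linv l) t \<in> supt (fst l)" "lact (linv l) t \<notin> foot m (linv l)"
proof -
  obtain a s where l: "l = (a, s)" by (cases l)
  have a: "pos_bump a" "a \<in> A" using assms pos by (auto simp: l)
  have t: "t \<in> supt a" using assms foot_subset_supt[of l] by (auto simp: l)
  then show "lact (linv l) t \<in> supt (fst l)" using lact_supt_iff[of "linv l" t] a by (simp add: l)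
  show "lact (linv l) t \<notin> foot m (linv l)"
  proof (cases s)
    case True
    have "a (inv a t) = t" using pos_bumpD(4)[OF a(1)] by (simp add: bij_is_surj surj_f_inv_f)
    moreover have "a (m a) \<le> t" using assms True by (simp add: l mem_foot_iff)
    ultimately have "m a \<le> inv a t"
      using strict_mono_less_eq[OF pos_bumpD(3)[OF a(1)], of "m a" "inv a t"] by simp
    then show ?thesis using True by (simp add: l linv_def mem_foot_iff lact_def)
  next
    case False
    then have "a t < a (m a)"
      using assms by (simp add: l mem_foot_iff strict_mono_less pos_bumpD(3)[OF a(1)])
    then show ?thesis using False by (simp add: l linv_def mem_foot_iff lact_def)
  qed
qed

lemma reduced_foot: "reduced_stack A m r (l # u) \<Longrightarrow> ev r (l # u) \<in> foot m l"
  using ping by simp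

text \<open>Feet are convex and disjoint, so one pair of points in order forces all pairs to be in
  that order.\<close>

lemma foot_less_trichotomy:
  assumes "fst k \<in> A" "fst l \<in> A" "k \<noteq> l"
  shows "foot_less (foot m k) (foot m l) \<or> foot_less (foot m l) (foot m k)"
proof -
  have less: "s' < t'"
    if "s \<in> foot m k" "s' \<in> foot m k" "t \<in> foot m l" "t' \<in> foot m l" "s < t" for s s' t t'
  proof (rule ccontr)
    assume "\<not> s' < t'"
    then show False
      using that foot_convex[of s k s' t'] foot_convex[of t' l t s]
        foot_unique[of k l t'] foot_unique[of k l s] assms by force
  qed
  show ?thesis
  proof (rule disjCI)
    assume "\<not> foot_less (foot m l) (foot m k)"
    then obtain s t where "s \<in> foot m k" "t \<in> foot m l" "\<not> t < s" by (auto simp: foot_less_def)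
    moreover from this have "s \<noteq> t" using foot_unique assms by blast
    ultimately show "foot_less (foot m k) (foot m l)"
      using less[of s _ t] by (auto simp: foot_less_def)
  qed
qed

lemma foot_less_iff:
  assumes "fst k \<in> A" "fst l \<in> A" "k \<noteq> l" "s \<in> foot m k" "t \<in> foot m l"
  shows "foot_less (foot m k) (foot m l) \<longleftrightarrow> s < t"
  using foot_less_trichotomy[OF assms(1-3)] assms(4,5)
  unfolding foot_less_def by (meson less_asym)

lemma foot_less_irrefl: "fst k \<in> A \<Longrightarrow> \<not> foot_less (foot m k) (foot m k)"
  using foot_nonempty unfolding foot_less_def by blast

lemma foot_less_src_dest: "a \<in> A \<Longrightarrow> foot_less (foot m (a, False)) (foot m (a, True))"
  using marker[of a] by (auto simp: foot_less_def mem_foot_iff)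

lemma foot_less_point:
  assumes "t \<notin> foot m l" "s \<in> foot m l"
  shows "foot_less (foot m l) {t} \<longleftrightarrow> s < t"
proof
  assume "s < t"
  then have "u < t" if "u \<in> foot m l" for u
    using that assms foot_convex[of s l u t] by force
  then show "foot_less (foot m l) {t}" by (simp add: foot_less_def)
qed (use assms in \<open>simp add: foot_less_def\<close>)

text \<open>The two feet of \<open>a\<close> fill both ends of its support, so what remains of the
  support is exactly the gap between them.\<close>

lemma supt_gap_iff:
  assumes "a \<in> A" "t \<notin> foot m (a, True)" "t \<notin> foot m (a, False)"
  shows "t \<in> supt a \<longleftrightarrow> foot_less (foot m (a, False)) {t} \<and> \<not> foot_less (foot m (a, True)) {t}"
proof -
  obtain s where s: "s \<in> foot m (a, False)" using foot_nonempty[of "(a, False)"] assms by auto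
  have "a (m a) \<in> foot m (a, True)" using marker[OF assms(1)] by (simp add: mem_foot_iff)
  then have "foot_less (foot m (a, True)) {t} \<longleftrightarrow> a (m a) < t"
    by (rule foot_less_point[OF assms(2)])
  moreover have "foot_less (foot m (a, False)) {t} \<longleftrightarrow> s < t"
    by (rule foot_less_point[OF assms(3) s])
  ultimately show ?thesis
    using assms s marker[OF assms(1)] by (auto simp: mem_supt_iff pos mem_foot_iff)
qed

text \<open>A foot of another bump avoids both feet of \<open>a\<close>, so it lies entirely in the
  gap between them or entirely outside \<open>supt a\<close>. Whether a bump moves a point of a foot
  is therefore decided by the order of the feet.\<close>

lemma supt_foot_iff:
  assumes "a \<in> A" "fst k \<in> A" "t \<in> foot m k"
  shows "t \<in> supt a \<longleftrightarrow> fst k = a \<or>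
    foot_less (foot m (a, False)) (foot m k) \<and> \<not> foot_less (foot m (a, True)) (foot m k)"
proof (cases "fst k = a")
  case True
  then show ?thesis using foot_subset_supt assms by blast
next
  case False
  then have ne: "(a, s) \<noteq> k" for s by auto
  have nt: "t \<notin> foot m (a, s)" for s using foot_unique[of "(a, s)" k t] ne assms by auto
  have "foot_less (foot m (a, s)) (foot m k) \<longleftrightarrow> foot_less (foot m (a, s)) {t}" for s
  proof -
    obtain v where "v \<in> foot m (a, s)" using foot_nonempty[of "(a, s)"] assms by auto
    then show ?thesis using foot_less_iff[OF _ assms(2) ne _ assms(3)] foot_less_point[OF nt] assms by simp
  qed
  then show ?thesis using supt_gap_iff[OF assms(1) nt nt] False by simp
qed

text \<open>The value of a nonempty stack lies in the foot of its top letter, which identifies that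
  letter; undoing it, one continues with shorter stacks. A base point outside all feet distinguishes
  the empty stack from the others.\<close>

lemma ev_inject:
  assumes "\<And>l. fst l \<in> A \<Longrightarrow> r \<notin> foot m l"
    and "reduced_stack A m r u" "reduced_stack A m r v" "ev r u = ev r v"
  shows "u = v"
  using assms(2-)
proof (induction u arbitrary: v)
  case Nil
  then show ?case
  proof (cases v)
    case (Cons l v')
    then have "r \<in> foot m l" using Nil reduced_foot[of r l v'] by simp
    then show ?thesis using assms(1) Nil Cons by auto
  qed simp
next
  case (Cons k u)
  show ?case
  proof (cases v)
    case Nil
    then have "r \<in> foot m k" using Cons reduced_foot[of r k u] by simp
    then show ?thesis using assms(1) Cons by auto
  next
    case (Cons l v')
    note v = this
    have "k = l"
      using foot_unique[of k l] reduced_foot[of r k u] reduced_foot[of r l v'] v Cons.prems by auto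
    moreover have "ev r u = ev r v'"
      using Cons.prems v \<open>k = l\<close> lact_linv[OF pos] by (metis ev.simps(2) reduced_stack.simps(2))
    ultimately show ?thesis using Cons.IH[of v'] Cons.prems v by simp
  qed
qed

end

section \<open>Comparing two ping-pong systems\<close>

text \<open>One format for generators, their inverses and single letters, so that the simulation of
  stacks is proved only once.\<close>

definition acts :: "(real \<Rightarrow> real) \<Rightarrow> letter set \<Rightarrow> bool" where
  "acts f L \<longleftrightarrow> (\<forall>t. (\<forall>l\<in>L. t \<in> supt (fst l) \<longrightarrow> f t = lact l t) \<and>
     ((\<forall>l\<in>L. t \<notin> supt (fst l)) \<longrightarrow> f t = t))"

lemma acts_inv:
  assumes "bij f" "acts f L" "\<And>l. l \<in> L \<Longrightarrow> pos_bump (fst l)"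
  shows "acts (inv f) (linv ` L)"
  unfolding acts_def
proof (intro allI conjI ballI impI)
  fix t k assume "k \<in> linv ` L" "t \<in> supt (fst k)"
  then obtain l where l: "l \<in> L" "k = linv l" "t \<in> supt (fst l)" by auto
  then have "lact k t \<in> supt (fst l)" using lact_supt_iff[of k t] assms(3) by auto
  then have "f (lact k t) = lact l (lact k t)" using assms(2) l by (simp add: acts_def)
  also have "\<dots> = t" using lact_linv[of k t] assms(3) l by simp
  finally show "inv f t = lact k t" using assms(1) by (metis bij_inv_eq_iff)
next
  fix t assume "\<forall>l\<in>linv ` L. t \<notin> supt (fst l)"
  then have "f t = t" using assms(2) by (simp add: acts_def)
  then show "inv f t = t" using assms(1) by (metis bij_inv_eq_iff)
qed

lemma acts_lact:
  assumes "pos_bump (fst l)"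
  shows "acts (lact l) {l}"
  using assms by (simp add: acts_def lact_outside)

definition lmap :: "((real \<Rightarrow> real) \<Rightarrow> (real \<Rightarrow> real)) \<Rightarrow> letter \<Rightarrow> letter" where
  "lmap \<sigma> l = (\<sigma> (fst l), snd l)"

lemma lmap_simps [simp]: "fst (lmap \<sigma> l) = \<sigma> (fst l)" "snd (lmap \<sigma> l) = snd l" "lmap \<sigma> (a, s) = (\<sigma> a, s)"
  by (simp_all add: lmap_def)

section \<open>Two systems whose feet are ordered alike\<close>

locale pingpong_iso = X: pingpong A m + Y: pingpong B n
  for A m B n +
  fixes \<sigma> :: "(real \<Rightarrow> real) \<Rightarrow> (real \<Rightarrow> real)"
  assumes sigma_bij: "bij_betw \<sigma> A B"
    and sigma_order: "fst k \<in> A \<Longrightarrow> fst l \<in> A \<Longrightarrow>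
      foot_less (foot m k) (foot m l) \<longleftrightarrow> foot_less (foot n (lmap \<sigma> k)) (foot n (lmap \<sigma> l))"
begin

lemma sigma_mem: "a \<in> A \<Longrightarrow> \<sigma> a \<in> B"
  using sigma_bij by (auto simp: bij_betw_def)

lemma sigma_eq_iff: "a \<in> A \<Longrightarrow> b \<in> A \<Longrightarrow> \<sigma> a = \<sigma> b \<longleftrightarrow> a = b"
  using sigma_bij by (auto simp: bij_betw_def inj_on_def)

lemma lmap_eq_iff: "fst k \<in> A \<Longrightarrow> fst l \<in> A \<Longrightarrow> lmap \<sigma> k = lmap \<sigma> l \<longleftrightarrow> k = l"
  by (auto simp: prod_eq_iff sigma_eq_iff)

lemma linv_lmap: "linv (lmap \<sigma> l) = lmap \<sigma> (linv l)"
  by (simp add: linv_def lmap_def)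

text \<open>Plays the role of a common top letter for empty stacks: the gap between feet that holds
  the base point gives the information otherwise given by the top foot.\<close>

definition same_gap :: "real \<Rightarrow> real \<Rightarrow> bool" where
  "same_gap r p \<longleftrightarrow> (\<forall>l. fst l \<in> A \<longrightarrow> r \<notin> foot m l \<and> p \<notin> foot n (lmap \<sigma> l) \<and>
     (foot_less (foot m l) {r} \<longleftrightarrow> foot_less (foot n (lmap \<sigma> l)) {p}))"

lemma same_gapD:
  assumes "same_gap r p" "fst l \<in> A"
  shows "r \<notin> foot m l" "p \<notin> foot n (lmap \<sigma> l)"
    "foot_less (foot m l) {r} \<longleftrightarrow> foot_less (foot n (lmap \<sigma> l)) {p}"
  using assms unfolding same_gap_def by blast+

lemma same_gap_supt:
  assumes "same_gap r p" "a \<in> A"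
  shows "r \<in> supt a \<longleftrightarrow> p \<in> supt (\<sigma> a)"
proof -
  have "r \<notin> foot m (a, s)" "p \<notin> foot n (\<sigma> a, s)"
    "foot_less (foot m (a, s)) {r} \<longleftrightarrow> foot_less (foot n (\<sigma> a, s)) {p}" for s
    using same_gapD[OF assms(1), of "(a, s)"] assms(2) by simp_all
  then show ?thesis
    using X.supt_gap_iff[OF assms(2), of r] Y.supt_gap_iff[OF sigma_mem[OF assms(2)], of p] by blast
qed

text \<open>The top foot of a nonempty stack settles the matter through
  \<open>supt_foot_iff\<close>; only the empty stack has to consult the base points. The disjunction
  in the hypothesis is what later permits exchanging base points below a nonempty stack.\<close>

lemma ev_supt_iff:
  assumes "reduced_stack A m r u" "reduced_stack B n p (map (lmap \<sigma>) u)" "u \<noteq> [] \<or> same_gap r p" "a \<in> A"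
  shows "ev r u \<in> supt a \<longleftrightarrow> ev p (map (lmap \<sigma>) u) \<in> supt (\<sigma> a)"
proof (cases u)
  case Nil
  then show ?thesis using assms same_gap_supt by simp
next
  case (Cons k v)
  have k: "fst k \<in> A" "fst (lmap \<sigma> k) \<in> B" using assms Cons by auto
  have "ev r u \<in> foot m k" using X.reduced_foot assms(1) Cons by blast
  moreover have "ev p (map (lmap \<sigma>) u) \<in> foot n (lmap \<sigma> k)"
    using Y.reduced_foot[of p "lmap \<sigma> k" "map (lmap \<sigma>) v"] assms(2) Cons by simp
  ultimately show ?thesis
    using X.supt_foot_iff[OF assms(4) k(1)] Y.supt_foot_iff[OF sigma_mem[OF assms(4)] k(2)]
      sigma_order[of "(a, True)" k] sigma_order[of "(a, False)" k] k(1) assms(4)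
    by (simp add: sigma_eq_iff)
qed

lemma ev_source_iff:
  assumes "reduced_stack A m r u" "reduced_stack B n p (map (lmap \<sigma>) u)" "u \<noteq> [] \<or> same_gap r p" "fst l \<in> A"
  shows "ev r u \<in> foot m l \<longleftrightarrow> ev p (map (lmap \<sigma>) u) \<in> foot n (lmap \<sigma> l)"
proof (cases u)
  case Nil
  then show ?thesis using assms same_gapD[of r p l] by simp
next
  case (Cons k v)
  have k: "fst k \<in> A" "fst (lmap \<sigma> k) \<in> B" using assms Cons by auto
  have "ev r u \<in> foot m k" using X.reduced_foot assms(1) Cons by blast
  then have "ev r u \<in> foot m l \<longleftrightarrow> k = l" using X.foot_unique k(1) assms(4) by blast
  moreover have "ev p (map (lmap \<sigma>) u) \<in> foot n (lmap \<sigma> k)"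
    using Y.reduced_foot[of p "lmap \<sigma> k" "map (lmap \<sigma>) v"] assms(2) Cons by simp
  then have "ev p (map (lmap \<sigma>) u) \<in> foot n (lmap \<sigma> l) \<longleftrightarrow> lmap \<sigma> k = lmap \<sigma> l"
    using Y.foot_unique[of "lmap \<sigma> k" "lmap \<sigma> l"] k(2) sigma_mem[OF assms(4)] by auto
  ultimately show ?thesis using lmap_eq_iff k(1) assms(4) by blast
qed

text \<open>\<open>v\<close> is a bottom part already known to be reduced on both sides: either
  \<open>[]\<close> over base points in the same gap, or a single letter over base points that need
  not be related.\<close>

lemma reduced_transfer:
  assumes "v \<noteq> [] \<or> same_gap r p" "reduced_stack A m r v" "reduced_stack B n p (map (lmap \<sigma>) v)"
    and "\<And>l. l \<in> set u \<Longrightarrow> fst l \<in> A"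
  shows "reduced_stack A m r (u @ v) \<longleftrightarrow> reduced_stack B n p (map (lmap \<sigma>) (u @ v))"
  using assms(4)
proof (induction u)
  case (Cons l u)
  have l: "fst l \<in> A" using Cons by simp
  have IH: "reduced_stack A m r (u @ v) \<longleftrightarrow> reduced_stack B n p (map (lmap \<sigma>) (u @ v))" using Cons by simp
  show ?case
  proof (cases "reduced_stack A m r (u @ v)")
    case True
    have "u @ v \<noteq> [] \<or> same_gap r p" using assms(1) by auto
    from ev_supt_iff[OF True IH[THEN iffD1, OF True] this l]
      ev_source_iff[OF True IH[THEN iffD1, OF True] this, of "linv l"]
    show ?thesis using IH l sigma_mem[OF l] by (simp add: linv_lmap)
  qed (use IH in auto)
qed (use assms in auto)

text \<open>Either the inverse letter is on top and is popped, or \<open>l\<close> is pushed. Both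
  systems make the same choice by \<open>ev_source_iff\<close>.\<close>

lemma simulate_letter:
  assumes u: "reduced_stack A m r u" "reduced_stack B n p (map (lmap \<sigma>) u)" "u \<noteq> [] \<or> same_gap r p"
    and l: "fst l \<in> A" "ev r u \<in> supt (fst l)"
  shows "\<exists>v. reduced_stack A m r v \<and> reduced_stack B n p (map (lmap \<sigma>) v) \<and> lact l (ev r u) = ev r v \<and>
    lact (lmap \<sigma> l) (ev p (map (lmap \<sigma>) u)) = ev p (map (lmap \<sigma>) v) \<and> length u \<le> length v + 1"
proof (cases "\<exists>v. u = linv l # v")
  case True
  then obtain v where v: "u = linv l # v" by blast
  have "lact l (ev r u) = ev r v" using v lact_linv[of "linv l"] X.pos l by simp
  moreover have "lact (lmap \<sigma> l) (ev p (map (lmap \<sigma>) u)) = ev p (map (lmap \<sigma>) v)"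
    using v lact_linv[of "linv (lmap \<sigma> l)"] Y.pos sigma_mem l by (simp add: linv_lmap)
  ultimately show ?thesis using u v by auto
next
  case False
  \<comment> \<open>The point lies in the foot of its top letter, or in no foot if the stack is
    empty; lying in the source of \<open>l\<close> would make \<open>linv l\<close> the top
    letter.\<close>
  have "ev r u \<notin> foot m (linv l)"
  proof (cases u)
    case Nil
    then show ?thesis using u l same_gapD[of r p "linv l"] by simp
  next
    case (Cons k v)
    then have "ev r u \<in> foot m k" using X.reduced_foot u by blast
    then show ?thesis using X.foot_unique[of k "linv l"] False Cons u l by auto
  qed
  moreover from this have "ev p (map (lmap \<sigma>) u) \<notin> foot n (linv (lmap \<sigma> l))"
    using ev_source_iff[OF u, of "linv l"] l by (simp add: linv_lmap)
  moreover have "ev p (map (lmap \<sigma>) u) \<in> supt (\<sigma> (fst l))" using ev_supt_iff[OF u] l by simp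
  ultimately have "reduced_stack A m r (l # u)" "reduced_stack B n p (map (lmap \<sigma>) (l # u))"
    using u l sigma_mem by auto
  then show ?thesis by (intro exI[of _ "l # u"]) simp
qed

text \<open>Either some letter of \<open>L\<close> moves the point and acts as \<open>f\<close>
  there, or nothing happens, alike on both sides. The bound on the lengths, a loss of at most one
  letter, is what \<open>traced\<close> accumulates.\<close>

lemma simulate:
  assumes u: "reduced_stack A m r u" "reduced_stack B n p (map (lmap \<sigma>) u)" "u \<noteq> [] \<or> same_gap r p"
    and L: "\<And>l. l \<in> L \<Longrightarrow> fst l \<in> A" and f: "acts f L" and g: "acts g (lmap \<sigma> ` L)"
  shows "\<exists>v. reduced_stack A m r v \<and> reduced_stack B n p (map (lmap \<sigma>) v) \<and> f (ev r u) = ev r v \<and>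
    g (ev p (map (lmap \<sigma>) u)) = ev p (map (lmap \<sigma>) v) \<and> length u \<le> length v + 1"
proof (cases "\<exists>l\<in>L. ev r u \<in> supt (fst l)")
  case True
  then obtain l where l: "l \<in> L" "ev r u \<in> supt (fst l)" by blast
  then have "ev p (map (lmap \<sigma>) u) \<in> supt (fst (lmap \<sigma> l))" using ev_supt_iff[OF u] L by simp
  then have "f (ev r u) = lact l (ev r u)"
    and "g (ev p (map (lmap \<sigma>) u)) = lact (lmap \<sigma> l) (ev p (map (lmap \<sigma>) u))"
    using f g l by (auto simp: acts_def)
  then show ?thesis using simulate_letter[OF u L[OF l(1)] l(2)] by simp
next
  case False
  then have "\<forall>k\<in>lmap \<sigma> ` L. ev p (map (lmap \<sigma>) u) \<notin> supt (fst k)"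
    using ev_supt_iff[OF u] L by auto
  then have "f (ev r u) = ev r u" "g (ev p (map (lmap \<sigma>) u)) = ev p (map (lmap \<sigma>) u)"
    using False f g by (auto simp: acts_def)
  then show ?thesis using u by (intro exI[of _ u]) simp
qed

text \<open>Equal top letters are peeled from both stacks, since letters act increasingly. Different
  top letters are compared through their feet; if one stack runs out, the gap of its base point
  decides, and if both do, the third hypothesis.\<close>

lemma ev_less_iff:
  assumes "same_gap r p" "same_gap q s" "r < q \<longleftrightarrow> p < s"
    and "reduced_stack A m r u" "reduced_stack B n p (map (lmap \<sigma>) u)"
    and "reduced_stack A m q v" "reduced_stack B n s (map (lmap \<sigma>) v)"
  shows "ev r u < ev q v \<longleftrightarrow> ev p (map (lmap \<sigma>) u) < ev s (map (lmap \<sigma>) v)"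
  using assms(4-)
proof (induction u arbitrary: v)
  case Nil
  show ?case
  proof (cases v)
    case Nil
    then show ?thesis using assms(3) by simp
  next
    case (Cons l v')
    let ?y = "ev q v" and ?z = "ev s (map (lmap \<sigma>) v)"
    have l: "fst l \<in> A" using Nil Cons by simp
    have y: "?y \<in> foot m l" using X.reduced_foot Nil Cons by blast
    have z: "?z \<in> foot n (lmap \<sigma> l)"
      using Y.reduced_foot[of s "lmap \<sigma> l" "map (lmap \<sigma>) v'"] Nil Cons by simp
    have g: "r \<notin> foot m l" "p \<notin> foot n (lmap \<sigma> l)"
      "foot_less (foot m l) {r} \<longleftrightarrow> foot_less (foot n (lmap \<sigma> l)) {p}"
      using same_gapD[OF assms(1) l] by auto
    have "?y < r \<longleftrightarrow> ?z < p"
      using X.foot_less_point[OF g(1) y] Y.foot_less_point[OF g(2) z] g(3) by blast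
    moreover have "?y \<noteq> r" "?z \<noteq> p" using y z g by auto
    ultimately show ?thesis by auto
  qed
next
  case (Cons k u)
  let ?y = "ev r (k # u)" and ?z = "ev p (map (lmap \<sigma>) (k # u))"
  have k: "fst k \<in> A" using Cons.prems by simp
  have y: "?y \<in> foot m k" using X.reduced_foot Cons.prems by blast
  have z: "?z \<in> foot n (lmap \<sigma> k)"
    using Y.reduced_foot[of p "lmap \<sigma> k" "map (lmap \<sigma>) u"] Cons.prems by simp
  show ?case
  proof (cases v)
    case Nil
    have g: "q \<notin> foot m k" "s \<notin> foot n (lmap \<sigma> k)"
      "foot_less (foot m k) {q} \<longleftrightarrow> foot_less (foot n (lmap \<sigma> k)) {s}"
      using same_gapD[OF assms(2) k] by auto
    have "?y < q \<longleftrightarrow> ?z < s"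
      using X.foot_less_point[OF g(1) y] Y.foot_less_point[OF g(2) z] g(3) by blast
    then show ?thesis using Nil by simp
  next
    case v: (Cons l v')
    let ?y' = "ev q v" and ?z' = "ev s (map (lmap \<sigma>) v)"
    have l: "fst l \<in> A" using Cons.prems v by simp
    show ?thesis
    proof (cases "k = l")
      case True
      have "ev r u < ev q v' \<longleftrightarrow> ev p (map (lmap \<sigma>) u) < ev s (map (lmap \<sigma>) v')"
        using Cons v by simp
      then show ?thesis
        using True v lact_less_iff[OF X.pos[OF k]] lact_less_iff[of "lmap \<sigma> k", OF Y.pos] sigma_mem[OF k]
        by simp
    next
      case False
      then have ne: "lmap \<sigma> k \<noteq> lmap \<sigma> l" using lmap_eq_iff k l by blast
      have y': "?y' \<in> foot m l" using X.reduced_foot Cons.prems v by blast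
      have z': "?z' \<in> foot n (lmap \<sigma> l)"
        using Y.reduced_foot[of s "lmap \<sigma> l" "map (lmap \<sigma>) v'"] Cons.prems v by simp
      show ?thesis
        using X.foot_less_iff[OF k l False y y'] Y.foot_less_iff[OF _ _ ne z z'] sigma_order[OF k l]
          sigma_mem k l by simp
    qed
  qed
qed

end

section \<open>Faithfulness\<close>

lemma lmap_id [simp]: "lmap id = id"
  by (rule ext) (simp add: lmap_def)

text \<open>The iterates increase inside the support, so they converge; by continuity the limit is a
  fixed point of \<open>a\<close> in the interval from \<open>lo a\<close> (excluded) to
  \<open>hi a\<close>, that is, \<open>hi a\<close>.\<close>

lemma iterates_tendsto_hi:
  assumes a: "pos_bump a" and t: "lo a < t" "t < hi a"
  shows "(\<lambda>k. (a ^^ k) t) \<longlonglongrightarrow> hi a"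
proof -
  let ?x = "\<lambda>k. (a ^^ k) t"
  have sup: "?x k \<in> supt a" for k
    by (induction k) (use t a in \<open>auto simp: mem_supt_iff[of a t] supt_image_iff pos_bumpD(1)\<close>)
  then have bd: "lo a < ?x k" "?x k < hi a" for k using a by (auto simp: mem_supt_iff)
  have inc: "incseq ?x"
  proof (rule incseq_SucI)
    fix k show "?x k \<le> ?x (Suc k)" using pos_bumpD(9)[OF a bd] by (simp add: less_imp_le)
  qed
  obtain L where L: "?x \<longlonglongrightarrow> L" "\<And>k. ?x k \<le> L"
    using incseq_convergent[OF inc, of "hi a"] bd by (auto simp: less_imp_le)
  have "(\<lambda>k. a (?x k)) \<longlonglongrightarrow> a L"
    using continuous_on_tendsto_compose[OF homeo_plus_continuous[of a UNIV] L(1)] pos_bumpD(1)[OF a] by simp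
  moreover have "(\<lambda>k. a (?x k)) \<longlonglongrightarrow> L" using LIMSEQ_Suc[OF L(1)] by simp
  ultimately have "a L = L" by (rule LIMSEQ_unique)
  then have "L \<notin> supt a" using a by (simp add: homeo_plus_supt pos_bumpD(1))
  moreover have "lo a < L" using bd(1)[of 0] L(2)[of 0] by simp
  moreover have "L \<le> hi a" using L(1) bd(2) by (meson LIMSEQ_le_const2 less_imp_le)
  ultimately have "L = hi a" using a by (simp add: mem_supt_iff)
  with L(1) show ?thesis by simp
qed

text \<open>Isolates what faithfulness takes from a canonical marking, with \<open>I\<close> as the
  set of initial bumps.\<close>

locale marked_pingpong = pingpong +
  fixes I :: "(real \<Rightarrow> real) set"
  assumes finite_A: "finite A"
    and I_subset: "I \<subseteq> A"
    and initial_marker: "a \<in> I \<Longrightarrow> fst l \<in> A \<Longrightarrow> m a \<notin> foot m l"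
    and noninitial_marker: "a \<in> A \<Longrightarrow> a \<notin> I \<Longrightarrow> \<exists>d\<in>A. lo d < lo a \<and> m a = d (m d)"
begin

text \<open>Comparing the system with itself means comparing the same stack over two base
  points.\<close>

interpretation self: pingpong_iso A m A m id
  by unfold_locales simp_all

text \<open>The set \<open>Mgen X\<close> in stack coordinates; the two are identified in
  \<open>Mgen_eq_pts\<close>.\<close>

definition pts :: "real set" where
  "pts = {ev (m a) u | a u. a \<in> I \<and> reduced_stack A m (m a) u}"

lemma ptsI: "a \<in> I \<Longrightarrow> reduced_stack A m (m a) u \<Longrightarrow> ev (m a) u \<in> pts"
  by (auto simp: pts_def)

lemma marker_avoids_own_feet:
  assumes "fst l \<in> A"
  shows "m (fst l) \<in> supt (fst l)" "m (fst l) \<notin> foot m l"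
  using marker[OF assms] assms by (auto simp: mem_supt_iff pos mem_foot_iff)

text \<open>Unwinding \<open>m a = d (m d)\<close> leads to bumps with smaller \<open>lo\<close>
  until an initial one is reached. On the way back \<open>d\<close> may be pushed, because
  \<open>m d\<close> lies in \<open>supt d\<close> but not in the source of \<open>d\<close>, which
  is open at \<open>m d\<close>.\<close>

lemma marker_in_pts:
  assumes "a \<in> A"
  shows "m a \<in> pts"
  using assms
proof (induction "card {b \<in> A. lo b < lo a}" arbitrary: a rule: less_induct)
  case less
  show ?case
  proof (cases "a \<in> I")
    case True
    then show ?thesis using ptsI[of a "[]"] by simp
  next
    case False
    then obtain d where d: "d \<in> A" "lo d < lo a" "m a = d (m d)"
      using noninitial_marker less.prems by blast
    have "card {b \<in> A. lo b < lo d} < card {b \<in> A. lo b < lo a}"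
      by (rule psubset_card_mono) (use d finite_A in auto)
    then have "m d \<in> pts" using less.hyps d by blast
    then obtain b u where u: "b \<in> I" "reduced_stack A m (m b) u" "m d = ev (m b) u"
      by (auto simp: pts_def)
    have "reduced_stack A m (m b) ((d, True) # u)"
      using u d marker_avoids_own_feet[of "linv (d, True)"] by (simp add: linv_def)
    from ptsI[OF u(1) this] show ?thesis using d(3) u(3) by (simp add: lact_def)
  qed
qed

lemma same_gap_refl:
  assumes "\<And>l. fst l \<in> A \<Longrightarrow> r \<notin> foot m l"
  shows "self.same_gap r r"
  using assms by (simp add: self.same_gap_def del: split_paired_All)

lemma acts_pts:
  assumes "acts f L" "\<And>l. l \<in> L \<Longrightarrow> fst l \<in> A" "t \<in> pts"
  shows "f t \<in> pts"
proof -
  obtain a u where u: "a \<in> I" "reduced_stack A m (m a) u" "t = ev (m a) u"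
    using assms(3) by (auto simp: pts_def)
  have "self.same_gap (m a) (m a)" using same_gap_refl initial_marker u(1) by blast
  then obtain v where "reduced_stack A m (m a) v" "f t = ev (m a) v"
    using self.simulate[of "m a" u "m a" L f f] u assms by auto
  then show ?thesis using ptsI u(1) by simp
qed

text \<open>Applying \<open>g\<close> changes only the top \<open>k\<close> letters of a stack, in a way that does not depend on
  the base point.\<close>
definition traced :: "(real \<Rightarrow> real) \<Rightarrow> nat \<Rightarrow> bool" where
  "traced g k \<longleftrightarrow> (\<forall>r p u. reduced_stack A m r u \<longrightarrow> reduced_stack A m p u \<longrightarrow>
     k < length u \<or> self.same_gap r p \<longrightarrow>
     (\<exists>v. reduced_stack A m r v \<and> reduced_stack A m p v \<and> g (ev r u) = ev r v \<and>
        g (ev p u) = ev p v \<and> length u \<le> length v + k))"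

lemma traced_id: "traced id 0"
  unfolding traced_def by fastforce

lemma traced_acts:
  assumes "acts f L" "\<And>l. l \<in> L \<Longrightarrow> fst l \<in> A"
  shows "traced f 1"
  unfolding traced_def
proof (intro allI impI)
  fix r p u
  assume u: "reduced_stack A m r u" "reduced_stack A m p u" "1 < length u \<or> self.same_gap r p"
  then have "u \<noteq> [] \<or> self.same_gap r p" by auto
  then show "\<exists>v. reduced_stack A m r v \<and> reduced_stack A m p v \<and> f (ev r u) = ev r v \<and>
      f (ev p u) = ev p v \<and> length u \<le> length v + 1"
    using self.simulate[of r u p L f f] u(1,2) assms by simp
qed

text \<open>A stack of more than \<open>j + k\<close> letters keeps more than \<open>k\<close> of
  them under \<open>g\<close>, enough for \<open>h\<close> to ignore the base point as well.\<close>

lemma traced_comp: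
  assumes "traced g j" "traced h k"
  shows "traced (h \<circ> g) (j + k)"
  unfolding traced_def
proof (intro allI impI)
  fix r p u
  assume u: "reduced_stack A m r u" "reduced_stack A m p u" "j + k < length u \<or> self.same_gap r p"
  then have "j < length u \<or> self.same_gap r p" by auto
  then obtain v where v: "reduced_stack A m r v" "reduced_stack A m p v" "g (ev r u) = ev r v"
    "g (ev p u) = ev p v" "length u \<le> length v + j"
    using assms(1) u(1,2) unfolding traced_def by blast
  then have "k < length v \<or> self.same_gap r p" using u(3) by auto
  then obtain w where "reduced_stack A m r w" "reduced_stack A m p w" "h (ev r v) = ev r w"
    "h (ev p v) = ev p w" "length v \<le> length w + k"
    using assms(2) v(1,2) unfolding traced_def by blast
  then show "\<exists>v. reduced_stack A m r v \<and> reduced_stack A m p v \<and> (h \<circ> g) (ev r u) = ev r v \<and>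
      (h \<circ> g) (ev p u) = ev p v \<and> length u \<le> length v + (j + k)"
    using v by (intro exI[of _ w]) simp
qed

text \<open>As long as the base point lies in a foot, \<open>pong\<close> supplies an earlier
  letter, added at the bottom of the stack. This may go on forever, hence the cut at
  \<open>k\<close> letters.\<close>

lemma history:
  "\<exists>r u. ev r u = t \<and> reduced_stack A m r u \<and>
     (length u = k \<or> (\<forall>l. fst l \<in> A \<longrightarrow> r \<notin> foot m l))"
proof (induction k)
  case 0
  show ?case by (intro exI[of _ t] exI[of _ "[]"]) simp
next
  case (Suc k)
  then obtain r u where u: "ev r u = t" "reduced_stack A m r u"
    "length u = k \<or> (\<forall>l. fst l \<in> A \<longrightarrow> r \<notin> foot m l)" by blast
  show ?case
  proof (cases "\<forall>l. fst l \<in> A \<longrightarrow> r \<notin> foot m l")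
    case True
    then show ?thesis using u by blast
  next
    case False
    then obtain l where l: "fst l \<in> A" "r \<in> foot m l" by blast
    let ?q = "lact (linv l) r"
    have "lact l ?q = r" using lact_linv[of "linv l" r] pos l by simp
    moreover have "reduced_stack A m ?q [l]" using pong[OF l] l by simp
    moreover have "length u = k" using u False by blast
    ultimately show ?thesis
      using u by (intro exI[of _ ?q] exI[of _ "u @ [l]"]) (simp add: ev_append reduced_append)
  qed
qed

text \<open>The right end of a foot, which the foot does not contain. Right ends are within reach of
  \<open>pts\<close>: each is a marker or a limit of iterates of a marker.\<close>

definition tip :: "letter \<Rightarrow> real" where
  "tip l = (if snd l then hi (fst l) else m (fst l))"

lemma foot_less_tip: "t \<in> foot m l \<Longrightarrow> t < tip l"
  by (auto simp: mem_foot_iff tip_def split: if_splits)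

lemma tip_le:
  assumes "fst l \<in> A" "foot_less (foot m l) {t}"
  shows "tip l \<le> t"
proof (rule ccontr)
  assume t: "\<not> tip l \<le> t"
  obtain s where s: "s \<in> foot m l" using foot_nonempty assms(1) by blast
  then have "s < t" using assms(2) by (simp add: foot_less_def)
  then have "t \<in> foot m l" using s t by (auto simp: mem_foot_iff tip_def split: if_splits)
  then show False using assms(2) by (auto simp: foot_less_def)
qed

text \<open>Take the rightmost tip among the feet to the left of \<open>r\<close>. It is at most
  \<open>r\<close>, and a foot containing it would also lie to the left of \<open>r\<close> and have
  a larger tip.\<close>

lemma tip_same_gap:
  assumes r: "\<And>l. fst l \<in> A \<Longrightarrow> r \<notin> foot m l"
    and k: "fst k \<in> A" "foot_less (foot m k) {r}"
  obtains l where "fst l \<in> A" "self.same_gap r (tip l)"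
proof -
  let ?K = "{l. fst l \<in> A \<and> foot_less (foot m l) {r}}"
  have "?K \<subseteq> A \<times> UNIV" by auto
  then have "finite ?K" using finite_A by (auto intro: finite_subset)
  moreover have "?K \<noteq> {}" using k by blast
  ultimately have "Max (tip ` ?K) \<in> tip ` ?K" "\<And>j. j \<in> ?K \<Longrightarrow> tip j \<le> Max (tip ` ?K)"
    by (auto intro!: Max_in Max_ge simp del: split_paired_All split_paired_Ex)
  then obtain l where l: "l \<in> ?K" "\<And>j. j \<in> ?K \<Longrightarrow> tip j \<le> tip l" by fastforce
  have le: "tip l \<le> r" using tip_le l(1) by blast
  have "tip l \<notin> foot m j" if j: "fst j \<in> A" for j
  proof
    assume t: "tip l \<in> foot m j"
    then have "tip l < r" using le r[OF j] by (cases "tip l = r") auto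
    then have "foot_less (foot m j) {r}" using foot_less_point[OF r[OF j] t] by blast
    then have "tip j \<le> tip l" using l(2) j by blast
    then show False using foot_less_tip[OF t] by simp
  qed
  moreover have "foot_less (foot m j) {r} \<longleftrightarrow> foot_less (foot m j) {tip l}" if j: "fst j \<in> A" for j
  proof
    assume "foot_less (foot m j) {r}"
    then have "tip j \<le> tip l" using l(2) j by blast
    then have "u < tip l" if "u \<in> foot m j" for u using foot_less_tip[OF that] by linarith
    then show "foot_less (foot m j) {tip l}" by (simp add: foot_less_def)
  next
    assume "foot_less (foot m j) {tip l}"
    then show "foot_less (foot m j) {r}" using le by (auto simp: foot_less_def)
  qed
  ultimately have "self.same_gap r (tip l)"
    using r by (simp add: self.same_gap_def del: split_paired_All)
  then show thesis using that l(1) by blast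
qed

lemma continuous_ev:
  assumes "\<And>l. l \<in> set u \<Longrightarrow> fst l \<in> A"
  shows "continuous_on UNIV (\<lambda>r. ev r u)"
  using assms
proof (induction u)
  case (Cons l u)
  then have "continuous_on UNIV (\<lambda>r. ev r u)" by simp
  moreover have "continuous_on UNIV (lact l)"
    using Cons.prems[of l] by (intro homeo_plus_continuous lact_homeo pos) simp
  ultimately show ?case
    using continuous_on_compose2[of UNIV "lact l" UNIV "\<lambda>r. ev r u"] by simp
qed simp

lemma lact_pts: "fst l \<in> A \<Longrightarrow> t \<in> pts \<Longrightarrow> lact l t \<in> pts"
  by (rule acts_pts[OF acts_lact]) (auto simp: pos)

lemma ev_pts:
  assumes "t \<in> pts" "\<And>l. l \<in> set u \<Longrightarrow> fst l \<in> A"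
  shows "ev t u \<in> pts"
  using assms(2) by (induction u) (auto simp: assms(1) intro: lact_pts)

text \<open>A source ends at a marker, so its tip is in \<open>pts\<close>. The tip of a destination
  is only a limit of points of \<open>pts\<close>, and the equation passes to the limit by
  continuity of \<open>g\<close> and of the stack.\<close>

lemma fixes_ev_tip:
  assumes g: "homeo_plus g" "\<And>t. t \<in> pts \<Longrightarrow> g t = t"
    and l: "fst l \<in> A" and u: "\<And>k. k \<in> set u \<Longrightarrow> fst k \<in> A"
  shows "g (ev (tip l) u) = ev (tip l) u"
proof (cases "snd l")
  case False
  then have "tip l \<in> pts" using marker_in_pts l by (simp add: tip_def)
  then show ?thesis using g(2) ev_pts u by blast
next
  case True
  let ?a = "fst l"
  let ?x = "\<lambda>k. (?a ^^ k) (m ?a)"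
  have "?x k \<in> pts" for k
  proof (induction k)
    case (Suc k)
    then show ?case using lact_pts[of "(?a, True)" "?x k"] l by (simp add: lact_def)
  qed (use marker_in_pts l in simp)
  then have fixed: "g (ev (?x k) u) = ev (?x k) u" for k using g(2) ev_pts u by blast
  have "?x \<longlonglongrightarrow> tip l"
    using iterates_tendsto_hi[of ?a "m ?a"] marker[OF l] pos l True by (simp add: tip_def)
  then have lim: "(\<lambda>k. ev (?x k) u) \<longlonglongrightarrow> ev (tip l) u"
    using continuous_on_tendsto_compose[OF continuous_ev[OF u]] by simp
  then have "(\<lambda>k. g (ev (?x k) u)) \<longlonglongrightarrow> g (ev (tip l) u)"
    using continuous_on_tendsto_compose[OF homeo_plus_continuous[OF g(1), of UNIV]] by simp
  then show ?thesis using lim fixed by (simp add: LIMSEQ_unique)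
qed

lemma reduced_stack_same_gap:
  assumes "self.same_gap r p" "reduced_stack A m r u"
  shows "reduced_stack A m p u"
  using self.reduced_transfer[of "[]" r p u] assms reduced_letters by auto

lemma faithful:
  assumes g: "homeo_plus g" "traced g k" "\<And>t. t \<in> pts \<Longrightarrow> g t = t"
  shows "g = id"
proof
  fix t
  \<comment> \<open>\<open>Suc k\<close> letters, because \<open>traced g k\<close> disregards the
    base point only for stacks of more than \<open>k\<close> letters.\<close>
  obtain r u where u: "ev r u = t" "reduced_stack A m r u"
    and dich: "length u = Suc k \<or> (\<forall>l. fst l \<in> A \<longrightarrow> r \<notin> foot m l)"
    using history by blast
  have letters: "\<And>l. l \<in> set u \<Longrightarrow> fst l \<in> A" using u(2) reduced_letters by blast
  show "g t = id t"
  proof (cases "\<forall>l. fst l \<in> A \<longrightarrow> r \<notin> foot m l")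
    case True
    then have r: "\<And>l. fst l \<in> A \<Longrightarrow> r \<notin> foot m l" by blast
    show ?thesis
    proof (cases "\<exists>l. fst l \<in> A \<and> foot_less (foot m l) {r}")
      case True
      then obtain l where l: "fst l \<in> A" "self.same_gap r (tip l)" using tip_same_gap[OF r] by blast
      then have pu: "reduced_stack A m (tip l) u" using reduced_stack_same_gap u(2) by blast
      then obtain v where v: "g t = ev r v" "g (ev (tip l) u) = ev (tip l) v" "reduced_stack A m (tip l) v"
        using g(2) u l unfolding traced_def by blast
      have "ev (tip l) u = ev (tip l) v" using fixes_ev_tip[OF g(1,3) l(1) letters] v(2) by simp
      moreover have "\<And>j. fst j \<in> A \<Longrightarrow> tip l \<notin> foot m j"
        using self.same_gapD(2)[OF l(2)] by simp
      ultimately have "u = v" using ev_inject pu v(3) by blast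
      then show ?thesis using v(1) u(1) by simp
    next
      case False
      \<comment> \<open>With no foot to its left, \<open>r\<close> lies in no support, so no letter
        can be applied to it; hence \<open>t = r\<close>, and \<open>g\<close> fixes it.\<close>
      have nil: "v = []" if v: "reduced_stack A m r v" for v
      proof (rule ccontr)
        assume "v \<noteq> []"
        then obtain l where "v = butlast v @ [l]" by (metis append_butlast_last_id)
        then have l: "fst l \<in> A" "r \<in> supt (fst l)"
          using v reduced_append[of A m r "butlast v" "[l]"] by auto
        then show False using supt_gap_iff[of "fst l" r] r False by auto
      qed
      have "self.same_gap r r" using same_gap_refl r by blast
      then obtain v where "g t = ev r v" "reduced_stack A m r v"
        using g(2) u unfolding traced_def by blast
      then show ?thesis using nil u by auto
    qed
  next
    case False
    then have len: "length u = Suc k" using dich by blast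
    then obtain u' l where u': "u = u' @ [l]" by (metis append_butlast_last_id length_0_conv nat.distinct(1))
    then have l: "fst l \<in> A" using letters by simp
    \<comment> \<open>The marker of the oldest letter lies in its support and in neither of its
      feet, so it can replace \<open>r\<close> under that letter. It may lie in a foot of another
      bump, so uniqueness is applied only after extending both stacks by \<open>w\<close> down to an
      initial marker.\<close>
    let ?p = "m (fst l)"
    have "?p \<in> pts" using marker_in_pts l by blast
    then obtain b w where w: "b \<in> I" "reduced_stack A m (m b) w" "?p = ev (m b) w"
      by (auto simp: pts_def)
    have "reduced_stack A m ?p [l]" using marker_avoids_own_feet[of "linv l"] l by simp
    then have pu: "reduced_stack A m ?p u"
      using self.reduced_transfer[of "[l]" r ?p u'] u(2) u' letters
      by (simp add: reduced_append)
    obtain v where v: "g t = ev r v" "g (ev ?p u) = ev ?p v" "reduced_stack A m ?p v"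
      using g(2) u pu len unfolding traced_def by (metis lessI)
    have "g (ev ?p u) = ev ?p u" using g(3) ev_pts \<open>?p \<in> pts\<close> letters by blast
    then have "ev (m b) (u @ w) = ev (m b) (v @ w)" using v(2) w(3) by (simp add: ev_append)
    moreover have "reduced_stack A m (m b) (u @ w)" "reduced_stack A m (m b) (v @ w)"
      using w pu v(3) by (auto simp: reduced_append)
    ultimately have "u = v" using ev_inject[of "m b"] initial_marker w(1) by blast
    then show ?thesis using v(1) u(1) by simp
  qed
qed

end

section \<open>The canonical marking\<close>

lemma disjoint_oo_oo:
  fixes x t y z :: real
  assumes "x < t" "y < z"
  shows "{x<..<t} \<inter> {y<..<z} = {} \<longleftrightarrow> t \<le> y \<or> z \<le> x"
proof
  assume e: "{x<..<t} \<inter> {y<..<z} = {}"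
  show "t \<le> y \<or> z \<le> x"
  proof (rule ccontr)
    assume "\<not> ?thesis"
    then obtain w where "max x y < w" "w < min t z" using assms dense[of "max x y" "min t z"] by auto
    then have "w \<in> {x<..<t} \<inter> {y<..<z}" by simp
    with e show False by blast
  qed
qed auto

lemma disjoint_oo_co:
  fixes x t y z :: real
  assumes "x < t" "y < z"
  shows "{x<..<t} \<inter> {y..<z} = {} \<longleftrightarrow> t \<le> y \<or> z \<le> x"
proof
  assume e: "{x<..<t} \<inter> {y..<z} = {}"
  then have "{x<..<t} \<inter> {y<..<z} = {}" by fastforce
  then show "t \<le> y \<or> z \<le> x" using disjoint_oo_oo[OF assms] by blast
qed auto

lemma disjoint_co_co:
  fixes x t y z :: real
  assumes "x < t" "y < z"
  shows "{x..<t} \<inter> {y..<z} = {} \<longleftrightarrow> t \<le> y \<or> z \<le> x"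
proof
  assume e: "{x..<t} \<inter> {y..<z} = {}"
  then have "{x<..<t} \<inter> {y<..<z} = {}" by fastforce
  then show "t \<le> y \<or> z \<le> x" using disjoint_oo_oo[OF assms] by blast
qed auto

text \<open>Disjointness of feet as inequalities between endpoints, so that the effect of moving a
  marker is a matter of linear arithmetic.\<close>

lemma pingpong_iff:
  "pingpong A m \<longleftrightarrow> (\<forall>a\<in>A. pos_bump a) \<and> (\<forall>a\<in>A. lo a < m a \<and> m a < hi a) \<and>
     (\<forall>c\<in>A. \<forall>d\<in>A. m c \<le> d (m d) \<or> hi d \<le> lo c) \<and>
     (\<forall>c\<in>A. \<forall>d\<in>A. c \<noteq> d \<longrightarrow> (m c \<le> lo d \<or> m d \<le> lo c) \<and> (hi c \<le> d (m d) \<or> hi d \<le> c (m c)))"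
  (is "_ \<longleftrightarrow> ?pos \<and> ?mark \<and> ?sd \<and> ?ssdd")
proof (cases "?pos \<and> ?mark")
  case True
  then have mk: "lo a < m a" "a (m a) < hi a" if "a \<in> A" for a
    using that supt_image_iff[of a "m a"] pos_bumpD(1)[of a] by (auto simp: mem_supt_iff)
  have "(src m c \<inter> dest m d = {} \<longleftrightarrow> m c \<le> d (m d) \<or> hi d \<le> lo c) \<and>
      (src m c \<inter> src m d = {} \<longleftrightarrow> m c \<le> lo d \<or> m d \<le> lo c) \<and>
      (dest m c \<inter> dest m d = {} \<longleftrightarrow> hi c \<le> d (m d) \<or> hi d \<le> c (m c))"
    if "c \<in> A" "d \<in> A" for c d
    unfolding src_def dest_def
    by (intro conjI disjoint_oo_oo disjoint_oo_co disjoint_co_co) (use that mk in auto)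
  then have "fast_marking A m \<longleftrightarrow> ?sd \<and> ?ssdd"
    using True unfolding fast_marking_def by (simp add: mem_supt_iff) blast
  then show ?thesis using True unfolding pingpong_def by blast
next
  case False
  then have "\<not> pingpong A m" using pingpong.pos pingpong.marker(1,4) by blast
  then show ?thesis using False by blast
qed

section \<open>Moving one marker to its canonical position\<close>

context pingpong
begin

lemma src_dest_apart: "c \<in> A \<Longrightarrow> d \<in> A \<Longrightarrow> m c \<le> d (m d) \<or> hi d \<le> lo c"
  and src_src_apart: "c \<in> A \<Longrightarrow> d \<in> A \<Longrightarrow> c \<noteq> d \<Longrightarrow> m c \<le> lo d \<or> m d \<le> lo c"
  and dest_dest_apart: "c \<in> A \<Longrightarrow> d \<in> A \<Longrightarrow> c \<noteq> d \<Longrightarrow> hi c \<le> d (m d) \<or> hi d \<le> c (m c)"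
  using pingpong_axioms unfolding pingpong_iff by blast+

lemma lo_inject: "c \<in> A \<Longrightarrow> d \<in> A \<Longrightarrow> lo c = lo d \<Longrightarrow> c = d"
  using src_src_apart[of c d] marker(1)[of c] marker(1)[of d] by force

lemma trans_pts_eq: "trans_pts A = lo ` A \<union> hi ` A"
  using trans_pts_bumps pos by blast

lemma isolated_trans_pts: "a \<in> A \<Longrightarrow> isolated A a \<Longrightarrow> t \<in> trans_pts A \<Longrightarrow> t \<le> lo a \<or> hi a \<le> t"
  using pos[of a] by (auto simp: isolated_def disjoint_iff mem_supt_iff) (meson not_le)

lemma s_pt_cases:
  assumes "finite A" "a \<in> A"
  shows "lo a < s_pt A a" "s_pt A a < hi a"
    and "t \<in> trans_pts A \<Longrightarrow> lo a < t \<Longrightarrow> s_pt A a \<le> t"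
    and "\<not> isolated A a \<Longrightarrow> s_pt A a \<in> trans_pts A"
proof -
  let ?T = "supt a \<inter> trans_pts A"
  have a: "pos_bump a" "lo a < hi a" using assms pos pos_bumpD(6) by auto
  have fin: "finite ?T" using assms by (simp add: trans_pts_eq)
  have "lo a < s_pt A a \<and> s_pt A a < hi a \<and> (t \<in> trans_pts A \<longrightarrow> lo a < t \<longrightarrow> s_pt A a \<le> t) \<and>
    (\<not> isolated A a \<longrightarrow> s_pt A a \<in> trans_pts A)"
  proof (cases "isolated A a")
    case True
    then have "s_pt A a = (lo a + hi a) / 2" by (simp add: s_pt_def)
    then show ?thesis using True isolated_trans_pts[OF assms(2) True, of t] a(2) by auto
  next
    case False
    then have sp: "s_pt A a = Min ?T" and "?T \<noteq> {}" by (simp_all add: s_pt_def isolated_def)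
    then have "s_pt A a \<in> ?T" using Min_in[OF fin] by simp
    then have b: "lo a < s_pt A a" "s_pt A a < hi a" "s_pt A a \<in> trans_pts A"
      using mem_supt_iff[OF a(1)] by auto
    moreover have "s_pt A a \<le> t" if "t \<in> trans_pts A" "lo a < t"
    proof (cases "t < hi a")
      case True
      then have "t \<in> ?T" using that mem_supt_iff[OF a(1)] by auto
      then show ?thesis using Min_le[OF fin] sp by simp
    qed (use b in linarith)
    ultimately show ?thesis by blast
  qed
  then show "lo a < s_pt A a" "s_pt A a < hi a"
    and "t \<in> trans_pts A \<Longrightarrow> lo a < t \<Longrightarrow> s_pt A a \<le> t"
    and "\<not> isolated A a \<Longrightarrow> s_pt A a \<in> trans_pts A"
    by blast+
qed

lemma initial_iff_not_hi:
  assumes "finite A" "a \<in> A"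
  shows "initial A a \<longleftrightarrow> isolated A a \<or> s_pt A a \<notin> hi ` A"
  using pos by (auto simp: initial_def right_tp_iff)

text \<open>No bump begins strictly between \<open>lo a\<close> and \<open>s_pt A a\<close>, so the
  new source meets no other source. Moving the marker to the right shrinks the destination. The
  midpoint of an isolated bump may lie left of the old marker, but no foot of another bump meets an
  isolated support. What remains, the new source against other destinations, is
  \<open>apart\<close>.\<close>

lemma pingpong_update:
  assumes fin: "finite A" and a: "a \<in> A" and v: "lo a < v" "v \<le> s_pt A a"
    and grow: "m a \<le> v \<or> isolated A a"
    and apart: "\<And>c. c \<in> A \<Longrightarrow> c \<noteq> a \<Longrightarrow> v \<le> c (m c) \<or> hi c \<le> lo a"
  shows "pingpong A (m(a := v))"
proof -
  note s = s_pt_cases[OF fin a]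
  have vhi: "v < hi a" using v s(2) by simp
  have av: "v < a v" "a v < hi a"
    using pos_bumpD(9)[OF pos[OF a], of v] supt_image_iff[OF pos_bumpD(1)[OF pos[OF a]], of v]
      v vhi pos[OF a] by (auto simp: mem_supt_iff)
  have av_grow: "a (m a) \<le> a v" if "m a \<le> v"
    using that by (simp add: strict_mono_less_eq[OF pos_bumpD(3)[OF pos[OF a]]])
  have no_lo: "v \<le> lo c" if "c \<in> A" "lo a < lo c" for c
    using s(3)[of "lo c"] that v by (auto simp: trans_pts_eq)
  have iso: "lo c \<le> lo a \<or> hi a \<le> lo c" "hi c \<le> lo a \<or> hi a \<le> hi c"
    if "c \<in> A" "isolated A a" for c
    using isolated_trans_pts[OF a that(2)] that(1) by (auto simp: trans_pts_eq)
  have sd: "m c \<le> a v \<or> hi a \<le> lo c" if c: "c \<in> A" "c \<noteq> a" for c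
    using grow
  proof
    assume "m a \<le> v"
    then show ?thesis using src_dest_apart[OF c(1) a] av_grow by linarith
  next
    assume "isolated A a"
    then show ?thesis
      using iso(1)[OF c(1)] src_src_apart[OF c(1) a c(2)] marker[OF a] av v by linarith
  qed
  have ss: "v \<le> lo d \<or> m d \<le> lo a" if d: "d \<in> A" "d \<noteq> a" for d
    using src_src_apart[OF d(1) a d(2)] no_lo[OF d(1)] marker[OF a] by linarith
  have dd: "hi a \<le> d (m d) \<or> hi d \<le> a v" if d: "d \<in> A" "d \<noteq> a" for d
    using grow
  proof
    assume "m a \<le> v"
    then show ?thesis using dest_dest_apart[OF d(1) a d(2)] av_grow by linarith
  next
    assume "isolated A a"
    then show ?thesis
      using iso(2)[OF d(1)] dest_dest_apart[OF d(1) a d(2)] marker[OF a] av v by linarith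
  qed
  show ?thesis
    unfolding pingpong_iff
  proof (intro conjI ballI impI)
    fix c d assume cd: "c \<in> A" "d \<in> A"
    show "(m(a := v)) c \<le> d ((m(a := v)) d) \<or> hi d \<le> lo c"
      using src_dest_apart[OF cd] sd apart cd av by (cases "c = a"; cases "d = a") auto
    assume ne: "c \<noteq> d"
    show "(m(a := v)) c \<le> lo d \<or> (m(a := v)) d \<le> lo c"
      using src_src_apart[OF cd ne] ss cd ne by (cases "c = a"; cases "d = a") auto
    show "hi c \<le> d ((m(a := v)) d) \<or> hi d \<le> c ((m(a := v)) c)"
      using dest_dest_apart[OF cd ne] dd cd ne by (cases "c = a"; cases "d = a") auto
  qed (use pos marker v vhi in auto)
qed

text \<open>The condition \<open>lo d < lo a\<close> makes the recursion well founded and keeps it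
  valid when markers further to the right are moved afterwards.\<close>

definition canonical :: "(real \<Rightarrow> real) \<Rightarrow> bool" where
  "canonical a \<longleftrightarrow> (if initial A a then m a = s_pt A a else \<exists>d\<in>A. lo d < lo a \<and> m a = d (m d))"

lemma canonical_value:
  assumes fin: "finite A" and a: "a \<in> A"
  obtains v where "pingpong A (m(a := v))"
    "if initial A a then v = s_pt A a else \<exists>d\<in>A. lo d < lo a \<and> v = d (m d)"
proof -
  note s = s_pt_cases[OF fin a]
  have s_le: "s_pt A a \<le> hi c" if "c \<in> A" "lo a < hi c" for c
    using s(3)[of "hi c"] that by (simp add: trans_pts_eq)
  consider (iso) "isolated A a" | (lo) e where "\<not> isolated A a" "initial A a" "e \<in> A" "s_pt A a = lo e"
    | (hi) d where "\<not> initial A a" "d \<in> A" "s_pt A a = hi d"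
    using s(4) initial_iff_not_hi[OF fin a] unfolding trans_pts_eq by blast
  then show thesis
  proof cases
    case iso
    have "s_pt A a \<le> c (m c) \<or> hi c \<le> lo a" if c: "c \<in> A" "c \<noteq> a" for c
      using dest_dest_apart[OF c(1) a c(2)] isolated_trans_pts[OF a iso, of "hi c"] c(1) marker[OF a] s(2)
      by (auto simp: trans_pts_eq)
    then have "pingpong A (m(a := s_pt A a))" using pingpong_update[OF fin a s(1)] iso by blast
    then show ?thesis using that[of "s_pt A a"] iso by (simp add: initial_def)
  next
    case lo
    have "lo a < lo e" using s(1) lo by simp
    then have "e \<noteq> a" by auto
    have "m a \<le> s_pt A a"
      using src_src_apart[OF lo(3) a \<open>e \<noteq> a\<close>] marker[OF lo(3)] \<open>lo a < lo e\<close> lo(4) by linarith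
    \<comment> \<open>No destination straddles \<open>lo e\<close>, where the source of
      \<open>e\<close> begins. One ending by \<open>lo e\<close> ends strictly earlier, as
      \<open>a\<close> is initial, and then by \<open>lo a\<close>, since \<open>s_pt A a\<close> is
      the first transition point after \<open>lo a\<close>.\<close>
    moreover have "s_pt A a \<le> c (m c) \<or> hi c \<le> lo a" if c: "c \<in> A" for c
    proof -
      have "s_pt A a \<noteq> hi c" using initial_iff_not_hi[OF fin a] lo c by blast
      then show ?thesis
        using src_dest_apart[OF lo(3) c] s_le[OF c] marker[OF lo(3)] lo(4) by linarith
    qed
    ultimately have "pingpong A (m(a := s_pt A a))" using pingpong_update[OF fin a s(1)] by blast
    then show ?thesis using that[of "s_pt A a"] lo by simp
  next
    case hi
    have "d \<noteq> a" using s(2) hi by auto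
    have md: "m a \<le> d (m d)" using src_dest_apart[OF a hi(2)] s(1) hi(3) by linarith
    have "\<not> lo a < lo d"
      using s(3)[of "lo d"] hi pos_bumpD(6)[OF pos[OF hi(2)]] by (auto simp: trans_pts_eq)
    then have lt: "lo d < lo a" using lo_inject[OF hi(2) a] \<open>d \<noteq> a\<close> by fastforce
    \<comment> \<open>If another bump \<open>c\<close> ends beyond \<open>lo a\<close>, it ends at
      or beyond \<open>s_pt A a = hi d\<close>, so its destination comes after that of
      \<open>d\<close>.\<close>
    have "d (m d) \<le> c (m c) \<or> hi c \<le> lo a" if c: "c \<in> A" for c
      using dest_dest_apart[OF c hi(2)] s_le[OF c] marker[OF hi(2)] hi(3) by (cases "c = d") auto
    then have "pingpong A (m(a := d (m d)))"
      using pingpong_update[OF fin a, of "d (m d)"] md marker[OF a] marker[OF hi(2)] hi(3) by auto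
    then show ?thesis using that[of "d (m d)"] hi lt by auto
  qed
qed

text \<open>For a non-isolated initial bump the marker is some \<open>lo e\<close>, and a
  destination containing it would run into the source of \<open>e\<close>, which begins there. An
  isolated support meets no foot of another bump.\<close>

lemma initial_marker_avoids_feet:
  assumes fin: "finite A" and a: "a \<in> A" and init: "initial A a" and can: "canonical a" and l: "fst l \<in> A"
  shows "m a \<notin> foot m l"
proof (cases "fst l = a")
  case True
  then show ?thesis using marker[OF a] by (auto simp: mem_foot_iff)
next
  case False
  let ?c = "fst l"
  note s = s_pt_cases[OF fin a]
  have ma: "m a = s_pt A a" using can init by (simp add: canonical_def)
  have "\<not> (lo ?c < m a \<and> m a < m ?c)"
    using src_src_apart[OF l a False] marker[OF a] by linarith
  moreover have "\<not> (?c (m ?c) \<le> m a \<and> m a < hi ?c)"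
  proof (cases "isolated A a")
    case True
    then show ?thesis
      using dest_dest_apart[OF l a False] isolated_trans_pts[OF a True, of "hi ?c"] l marker[OF a]
      by (auto simp: trans_pts_eq)
  next
    case False
    then obtain e where e: "e \<in> A" "m a = lo e"
      using s(4) init initial_iff_not_hi[OF fin a] ma by (auto simp: trans_pts_eq)
    then show ?thesis using src_dest_apart[OF e(1) l] marker[OF e(1)] by linarith
  qed
  ultimately show ?thesis by (simp add: mem_foot_iff)
qed

lemma foot_less_srcI:
  assumes "a \<in> A" "fst k \<in> A" "k \<noteq> (a, False)" "m a \<le> t" "t \<in> foot m k"
  shows "foot_less (foot m (a, False)) (foot m k)"
proof -
  obtain u where u: "u \<in> foot m (a, False)" using foot_nonempty[of "(a, False)"] assms by auto
  then have "u < t" using assms by (simp add: mem_foot_iff)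
  then show ?thesis using foot_less_iff[OF _ assms(2) assms(3)[symmetric] u assms(5)] assms(1) by simp
qed

text \<open>Initiality can be read off the order of the feet, so diagram isomorphisms preserve it.\<close>
lemma noninitial_iff:
  assumes fin: "finite A" and a: "a \<in> A" and can: "canonical a"
  shows "\<not> initial A a \<longleftrightarrow> (\<exists>d\<in>A. d \<noteq> a \<and> foot_less (foot m (a, False)) (foot m (d, True)) \<and>
    (\<forall>k. fst k \<in> A \<longrightarrow> \<not> (foot_less (foot m (a, False)) (foot m k) \<and> foot_less (foot m k) (foot m (d, True)))))"
    (is "_ \<longleftrightarrow> ?R")
proof
  assume "\<not> initial A a"
  then obtain d where d: "d \<in> A" "lo d < lo a" "m a = d (m d)" using can by (auto simp: canonical_def)
  have dd: "d (m d) \<in> foot m (d, True)" using marker[OF d(1)] by (simp add: mem_foot_iff)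
  have "foot_less (foot m (a, False)) (foot m (d, True))"
    using foot_less_srcI[OF a _ _ _ dd] d by simp
  moreover have False if k: "fst k \<in> A" "foot_less (foot m (a, False)) (foot m k)"
    "foot_less (foot m k) (foot m (d, True))" for k
  proof -
    obtain t where t: "t \<in> foot m k" using foot_nonempty k by blast
    have "t < m a" using k(3) t dd d(3) by (auto simp: foot_less_def)
    then obtain u where "max (lo a) t < u" "u < m a" using dense[of "max (lo a) t" "m a"] marker[OF a] by auto
    then have "u \<in> foot m (a, False)" "t < u" by (auto simp: mem_foot_iff)
    then show False using k(2) t unfolding foot_less_def by (meson less_asym)
  qed
  moreover have "d \<noteq> a" using d(2) by auto
  ultimately show ?R using d(1) by blast
next
  assume ?R
  then obtain d where d: "d \<in> A" "d \<noteq> a" "foot_less (foot m (a, False)) (foot m (d, True))"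
    and between: "\<And>k. fst k \<in> A \<Longrightarrow> foot_less (foot m (a, False)) (foot m k) \<Longrightarrow>
      foot_less (foot m k) (foot m (d, True)) \<Longrightarrow> False" by blast
  note s = s_pt_cases[OF fin a]
  have dd: "d (m d) \<in> foot m (d, True)" using marker[OF d(1)] by (simp add: mem_foot_iff)
  have md: "m a \<le> d (m d)"
  proof (rule ccontr)
    assume "\<not> ?thesis"
    then obtain u where "max (lo a) (d (m d)) < u" "u < m a"
      using dense[of "max (lo a) (d (m d))" "m a"] marker[OF a] by auto
    then have "u \<in> foot m (a, False)" "d (m d) < u" by (auto simp: mem_foot_iff)
    then show False using d(3) dd unfolding foot_less_def by (meson less_asym)
  qed
  \<comment> \<open>Otherwise the destination of \<open>a\<close> itself would stand between the two
    feet.\<close>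
  have "\<not> hi a \<le> d (m d)"
  proof
    assume "hi a \<le> d (m d)"
    then have "foot_less (foot m (a, True)) (foot m (d, True))" by (auto simp: foot_less_def mem_foot_iff)
    then show False using between[of "(a, True)"] foot_less_src_dest[OF a] a by simp
  qed
  then have hd: "lo a < hi d" "hi d < hi a"
    using dest_dest_apart[OF a d(1)] d(2) marker[OF a] marker[OF d(1)] md by auto
  then have noniso: "\<not> isolated A a" using isolated_trans_pts[OF a, of "hi d"] d(1) by (auto simp: trans_pts_eq)
  \<comment> \<open>If the first transition point were only a left end \<open>lo e\<close>, the
    source of \<open>e\<close> would stand between the source of \<open>a\<close> and the
    destination of \<open>d\<close>.\<close>
  have "s_pt A a \<in> hi ` A"
  proof (rule ccontr)
    assume nh: "s_pt A a \<notin> hi ` A"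
    then obtain e where e: "e \<in> A" "s_pt A a = lo e" using s(4)[OF noniso] by (auto simp: trans_pts_eq)
    have "lo e < hi d" using s(3)[of "hi d"] hd(1) d(1) nh e by (force simp: trans_pts_eq)
    then have me: "m e \<le> d (m d)" using src_dest_apart[OF e(1) d(1)] by linarith
    have "e \<noteq> a" using e s(1) by auto
    then have mae: "m a \<le> lo e" using src_src_apart[OF a e(1)] marker[OF e(1)] s(1) e(2) by fastforce
    obtain t where t: "t \<in> foot m (e, False)" using foot_nonempty[of "(e, False)"] e by auto
    then have "m a \<le> t" using mae by (simp add: mem_foot_iff)
    then have "foot_less (foot m (a, False)) (foot m (e, False))"
      using foot_less_srcI[OF a _ _ _ t] e \<open>e \<noteq> a\<close> by simp
    moreover have "foot_less (foot m (e, False)) (foot m (d, True))"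
      using foot_less_srcI[OF e(1) _ _ me dd] d by simp
    ultimately show False using between[of "(e, False)"] e by simp
  qed
  then show "\<not> initial A a" using initial_iff_not_hi[OF fin a] noniso by blast
qed

end

text \<open>Markers are moved one at a time by increasing \<open>lo\<close>. Bumps treated earlier
  stay canonical, because their markers refer only to bumps still further to the left.\<close>

lemma canonical_marking_exists:
  assumes "pingpong A m" and fin: "finite A"
  shows "\<exists>m'. pingpong A m' \<and> (\<forall>a\<in>A. pingpong.canonical A m' a)"
proof -
  let ?rank = "\<lambda>a. card {b \<in> A. lo b < lo a}"
  have rank_less: "?rank b < ?rank a" if "b \<in> A" "lo b < lo a" for a b
    by (rule psubset_card_mono) (use that fin in auto)
  have "\<exists>m'. pingpong A m' \<and> (\<forall>a\<in>A. ?rank a < k \<longrightarrow> pingpong.canonical A m' a)" for k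
  proof (induction k)
    case 0
    then show ?case using assms by auto
  next
    case (Suc k)
    then obtain m' where m': "pingpong A m'" "\<And>a. a \<in> A \<Longrightarrow> ?rank a < k \<Longrightarrow> pingpong.canonical A m' a"
      by blast
    show ?case
    proof (cases "\<exists>a\<in>A. ?rank a = k")
      case False
      then have "?rank a < k" if "a \<in> A" "?rank a < Suc k" for a
        using that by (auto simp: less_Suc_eq)
      then show ?thesis using m' by blast
    next
      case True
      then obtain a where a: "a \<in> A" "?rank a = k" by blast
      interpret pingpong A m' by (rule m')
      obtain v where v: "pingpong A (m'(a := v))"
        "if initial A a then v = s_pt A a else \<exists>d\<in>A. lo d < lo a \<and> v = d (m' d)"
        using canonical_value[OF fin a(1)] by blast
      interpret v: pingpong A "m'(a := v)" by (rule v)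
      have "v.canonical b" if b: "b \<in> A" "?rank b < Suc k" for b
      proof (cases "b = a")
        case True
        then show ?thesis using v(2) unfolding v.canonical_def by (auto split: if_splits)
      next
        case False
        then have "lo a \<noteq> lo b" using lo_inject a(1) b(1) by metis
        then have "?rank b < k"
          using rank_less[OF a(1), of b] rank_less[OF b(1), of a] a(2) b(2) by linarith
        then have "canonical b" using m'(2) b(1) by blast
        moreover have "d \<noteq> a" if "d \<in> A" "lo d < lo b" for d
          using rank_less[OF that] \<open>?rank b < k\<close> a(2) by auto
        ultimately show ?thesis using False unfolding canonical_def v.canonical_def by (auto split: if_splits)
      qed
      then show ?thesis using v(1) by blast
    qed
  qed
  moreover have "?rank a < Suc (card A)" for a
    using fin by (simp add: card_mono less_Suc_eq_le)
  ultimately show ?thesis by blast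
qed

text \<open>The feet of one letter under two markings share an end of the support and hence overlap;
  points common to both can be compared under either marking.\<close>

lemma foot_less_marking_independent:
  assumes "pingpong A m" "pingpong A n" "fst k \<in> A" "fst l \<in> A"
  shows "foot_less (foot m k) (foot m l) \<longleftrightarrow> foot_less (foot n k) (foot n l)"
proof (cases "k = l")
  case True
  then show ?thesis using pingpong.foot_less_irrefl assms by blast
next
  case False
  have common: "\<exists>t. t \<in> foot m j \<and> t \<in> foot n j" if j: "fst j \<in> A" for j
  proof (cases "snd j")
    case True
    then show ?thesis
      using pingpong.marker[OF assms(1) j] pingpong.marker[OF assms(2) j]
      by (intro exI[of _ "max (fst j (m (fst j))) (fst j (n (fst j)))"])
        (simp add: pingpong.mem_foot_iff[OF assms(1)] pingpong.mem_foot_iff[OF assms(2)])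
  next
    case False
    then show ?thesis
      using pingpong.marker[OF assms(1) j] pingpong.marker[OF assms(2) j]
        dense[of "lo (fst j)" "min (m (fst j)) (n (fst j))"]
      by (auto simp: pingpong.mem_foot_iff[OF assms(1)] pingpong.mem_foot_iff[OF assms(2)])
  qed
  obtain s t where "s \<in> foot m k" "s \<in> foot n k" "t \<in> foot m l" "t \<in> foot n l"
    using common assms(3,4) by blast
  then show ?thesis
    using pingpong.foot_less_iff[OF assms(1,3,4) False] pingpong.foot_less_iff[OF assms(2,3,4) False] by simp
qed

section \<open>Dynamical diagrams\<close>

definition signed_letters :: "(real \<Rightarrow> real) set \<Rightarrow> (real \<Rightarrow> real) \<Rightarrow> letter set" where
  "signed_letters X f = {l. fst l \<in> bumps_used X \<and> (\<forall>t\<in>supt (fst l). f t = lact l t)}"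

lemma bumps_used_iff:
  "a \<in> bumps_used X \<longleftrightarrow> pos_bump a \<and> (\<exists>f\<in>X. \<exists>s. \<forall>t\<in>supt a. f t = lact (a, s) t)"
  by (auto simp: bumps_used_def used_in_def lact_def ex_bool_eq)

lemma bump_letter:
  assumes "bump b"
  obtains l where "pos_bump (fst l)" "lact l = b"
proof -
  have "inv (inv b) = b" using assms by (simp add: bump_def homeo_plus_bij inv_inv_eq)
  then show thesis
    using bump_cases[OF assms] that[of "(b, True)"] that[of "(inv b, False)"] by (auto simp: lact_def)
qed

lemma signed_bump_letter:
  assumes "f \<in> X" "signed_bump b f"
  obtains l where "l \<in> signed_letters X f" "lact l = b" "supt (fst l) = supt b"
proof -
  obtain l where l: "pos_bump (fst l)" "lact l = b"
    using bump_letter assms(2) by (auto simp: signed_bump_def)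
  have s: "supt (fst l) = supt b" using supt_lact[OF l(1)] l(2) by simp
  then have agree: "\<forall>t\<in>supt (fst l). f t = lact l t" using assms(2) l(2) by (simp add: signed_bump_def)
  then have "fst l \<in> bumps_used X"
    using l(1) assms(1) unfolding bumps_used_iff by (metis prod.collapse)
  then show thesis using that[of l] agree l(2) s by (simp add: signed_letters_def)
qed

lemma acts_signed_letters:
  assumes "f \<in> X" "homeo_plus f"
  shows "acts f (signed_letters X f)"
  unfolding acts_def
proof (intro allI conjI ballI impI)
  fix t assume out: "\<forall>l\<in>signed_letters X f. t \<notin> supt (fst l)"
  show "f t = t"
  proof (rule ccontr)
    assume "f t \<noteq> t"
    then obtain b where "signed_bump b f" "t \<in> supt b" using signed_bump_at assms(2) by blast
    then show False using signed_bump_letter[OF assms(1)] out by metis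
  qed
qed (simp add: signed_letters_def)

text \<open>Makes \<open>bumps_used X\<close> finite, \<open>lo\<close> being injective on it. On
  \<open>supt a\<close> the element \<open>f\<close> agrees with \<open>a\<close> or its inverse, by
  continuity also at \<open>lo a\<close>, which is therefore fixed by \<open>f\<close>.\<close>

lemma lo_in_trans_pts:
  assumes X: "\<And>f. f \<in> X \<Longrightarrow> homeo_plus f" and a: "a \<in> bumps_used X"
  shows "lo a \<in> trans_pts X"
proof -
  obtain f s where f: "f \<in> X" "\<And>t. t \<in> supt a \<Longrightarrow> f t = lact (a, s) t" and pa: "pos_bump a"
    using a by (auto simp: bumps_used_iff)
  let ?l = "(a, s)"
  have hl: "homeo_plus (lact ?l)" by (simp add: lact_homeo pa)
  have "closed {t. f t = lact ?l t}"
    by (intro closed_Collect_eq homeo_plus_continuous X f(1) hl)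
  moreover have "{lo a<..<hi a} \<subseteq> {t. f t = lact ?l t}" using f(2) by (auto simp: mem_supt_iff[OF pa])
  ultimately have "closure {lo a<..<hi a} \<subseteq> {t. f t = lact ?l t}" by (rule closure_minimal[rotated])
  then have "f (lo a) = lact ?l (lo a)" using pos_bumpD(6)[OF pa] by (auto simp: subset_iff)
  also have "\<dots> = lo a" by (rule lact_outside) (simp_all add: pa mem_supt_iff)
  finally have "lo a \<notin> supt f" by (simp add: supt_def)
  moreover have "supt a \<subseteq> supt f"
  proof
    fix t assume t: "t \<in> supt a"
    then have "lact ?l t \<noteq> t" using supt_lact[of ?l] pa homeo_plus_supt[OF hl] by auto
    then show "t \<in> supt f" using f(2)[OF t] t by (auto simp: supt_def)
  qed
  moreover have "left_tp a (lo a)" using left_tp_iff[OF pa] by simp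
  ultimately have "left_tp f (lo a)" unfolding left_tp_def by blast
  then show ?thesis using f(1) by (auto simp: trans_pts_def)
qed

lemma feet_of_lact:
  assumes "pos_bump (fst l)"
  shows "sfoot m (lact l) = foot m (linv l)" "tfoot m (lact l) = foot m l"
proof -
  let ?a = "fst l"
  have h: "homeo_plus ?a" using assms by (rule pos_bumpD(1))
  have up: "\<forall>t\<in>supt ?a. ?a t > t" using assms by (simp add: pos_bump_def)
  then have "\<forall>t\<in>supt ?a. inv ?a t < t" using moved_up_iff_inv_down[OF h] by blast
  moreover have "supt ?a \<noteq> {}" using pos_bumpD(2)[OF assms] by (simp add: bump_iff_connected)
  ultimately have "\<not> (\<forall>t\<in>supt ?a. inv ?a t > t)" by (meson ex_in_conv less_asym)
  moreover have "inv (inv ?a) = ?a" by (simp add: h homeo_plus_bij inv_inv_eq)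
  ultimately show "sfoot m (lact l) = foot m (linv l)" "tfoot m (lact l) = foot m l"
    using up by (auto simp: sfoot_def tfoot_def lact_def linv_def foot_def supt_inv h)
qed

lemma edges_eq:
  "edges X m = {(foot m (linv l), foot m l, f) | l f. f \<in> X \<and> l \<in> signed_letters X f}"
proof (intro equalityI subsetI)
  fix e assume "e \<in> edges X m"
  then obtain b f where b: "f \<in> X" "signed_bump b f" "e = (sfoot m b, tfoot m b, f)"
    by (auto simp: edges_def)
  then obtain l where l: "l \<in> signed_letters X f" "lact l = b" using signed_bump_letter by metis
  then have "pos_bump (fst l)" by (simp add: signed_letters_def bumps_used_iff)
  then show "e \<in> {(foot m (linv l), foot m l, f) | l f. f \<in> X \<and> l \<in> signed_letters X f}"
    using feet_of_lact[of l m] b l by (simp del: split_paired_Ex) blast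
next
  fix e assume "e \<in> {(foot m (linv l), foot m l, f) | l f. f \<in> X \<and> l \<in> signed_letters X f}"
  then obtain l f where l: "f \<in> X" "l \<in> signed_letters X f" "e = (foot m (linv l), foot m l, f)" by blast
  then have p: "pos_bump (fst l)" by (simp add: signed_letters_def bumps_used_iff)
  then have "bump (lact l)" using pos_bumpD(2) bump_inv by (simp add: lact_def)
  then have "signed_bump (lact l) f"
    using l(2) supt_lact[OF p] by (simp add: signed_bump_def signed_letters_def)
  moreover have "e = (sfoot m (lact l), tfoot m (lact l), f)" using l(3) feet_of_lact[OF p] by simp
  ultimately show "e \<in> edges X m" using l(1) unfolding edges_def by blast
qed

lemma vertices_eq: "vertices X m = {foot m l | l. fst l \<in> bumps_used X}"
proof -
  have "vertices X m = (\<Union>a\<in>bumps_used X. {foot m (a, False), foot m (a, True)})"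
    by (simp add: vertices_def foot_def)
  then show ?thesis by (auto simp: split_paired_Ex) (metis (full_types))
qed

lemma edge_iff_letter:
  assumes "pingpong (bumps_used X) m" "fst l \<in> bumps_used X" "f \<in> X"
  shows "(foot m (linv l), foot m l, f) \<in> edges X m \<longleftrightarrow> l \<in> signed_letters X f"
proof
  assume "(foot m (linv l), foot m l, f) \<in> edges X m"
  then obtain k where k: "k \<in> signed_letters X f" "foot m l = foot m k" by (auto simp: edges_eq)
  then have "l = k" using pingpong.foot_inject[OF assms(1,2)] by (auto simp: signed_letters_def)
  then show "l \<in> signed_letters X f" using k(1) by simp
qed (use assms in \<open>simp add: edges_eq del: split_paired_Ex; blast\<close>)

lemma (in pingpong) foot_less_linv_iff:
  assumes "fst l \<in> A"
  shows "foot_less (foot m (linv l)) (foot m l) \<longleftrightarrow> snd l"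
proof -
  obtain a s where l: "l = (a, s)" by (cases l)
  then have a: "a \<in> A" using assms by simp
  obtain u v where uv: "u \<in> foot m (a, False)" "v \<in> foot m (a, True)"
    using foot_nonempty[of "(a, False)"] foot_nonempty[of "(a, True)"] a by auto
  then have "u < v" using foot_less_src_dest[OF a] unfolding foot_less_def by blast
  then have "\<not> foot_less (foot m (a, True)) (foot m (a, False))"
    using foot_less_iff[OF _ _ _ uv(2,1)] a by simp
  then show ?thesis using foot_less_src_dest[OF a] by (cases s) (auto simp: l linv_def)
qed

text \<open>Each bump in use spans an edge, so its two feet go to the two feet of one bump. The
  order of tail and head of an edge reveals its sign, so signs are preserved and \<psi> comes from a
  map \<sigma> of positive bumps.\<close>

lemma diagram_iso_bumps:
  assumes iso: "diagram_iso X mX Y mY \<psi> \<tau>"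
    and ppX: "pingpong (bumps_used X) mX" and ppY: "pingpong (bumps_used Y) mY"
  obtains \<sigma> where "pingpong_iso (bumps_used X) mX (bumps_used Y) mY \<sigma>"
    "\<And>f. f \<in> X \<Longrightarrow> signed_letters Y (\<tau> f) = lmap \<sigma> ` signed_letters X f"
proof -
  let ?A = "bumps_used X" and ?B = "bumps_used Y"
  interpret PX: pingpong ?A mX by (rule ppX)
  interpret PY: pingpong ?B mY by (rule ppY)
  have psi: "bij_betw \<psi> (vertices X mX) (vertices Y mY)"
    and ord: "\<And>U W. U \<in> vertices X mX \<Longrightarrow> W \<in> vertices X mX \<Longrightarrow> foot_less U W \<longleftrightarrow> foot_less (\<psi> U) (\<psi> W)"
    and tau: "bij_betw \<tau> X Y"
    and edge: "\<And>U W f. U \<in> vertices X mX \<Longrightarrow> W \<in> vertices X mX \<Longrightarrow> f \<in> X \<Longrightarrow>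
      (U, W, f) \<in> edges X mX \<longleftrightarrow> (\<psi> U, \<psi> W, \<tau> f) \<in> edges Y mY"
    using iso unfolding diagram_iso_def by blast+
  have vX: "foot mX l \<in> vertices X mX" if "fst l \<in> ?A" for l using that unfolding vertices_eq by blast
  have "\<exists>b. b \<in> ?B \<and> (\<forall>s. \<psi> (foot mX (a, s)) = foot mY (b, s))" if a: "a \<in> ?A" for a
  proof -
    obtain f s where f: "f \<in> X" "(a, s) \<in> signed_letters X f"
      using a bumps_used_iff[of a X] by (auto simp: signed_letters_def)
    let ?l = "(a, s)"
    have "(\<psi> (foot mX (linv ?l)), \<psi> (foot mX ?l), \<tau> f) \<in> edges Y mY"
      using edge[of "foot mX (linv ?l)" "foot mX ?l" f] edge_iff_letter[OF ppX _ f(1), of ?l] f a vX by simp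
    then obtain b s' where b: "\<psi> (foot mX (linv ?l)) = foot mY (linv (b, s'))"
      "\<psi> (foot mX ?l) = foot mY (b, s')" "b \<in> ?B"
      by (auto simp: edges_eq signed_letters_def)
    have "foot_less (foot mX (linv ?l)) (foot mX ?l) \<longleftrightarrow> s"
      using PX.foot_less_linv_iff[of ?l] a by simp
    moreover have "foot_less (foot mY (linv (b, s'))) (foot mY (b, s')) \<longleftrightarrow> s'"
      using PY.foot_less_linv_iff[of "(b, s')"] b(3) by simp
    ultimately have "s = s'" using ord[of "foot mX (linv ?l)" "foot mX ?l"] vX a b by simp
    then have "\<psi> (foot mX (a, r)) = foot mY (b, r)" for r
      using b by (cases "r = s") (auto simp: linv_def)
    then show ?thesis using b(3) by blast
  qed
  then obtain \<sigma> where \<sigma>: "\<And>a. a \<in> ?A \<Longrightarrow> \<sigma> a \<in> ?B" "\<And>a s. a \<in> ?A \<Longrightarrow> \<psi> (foot mX (a, s)) = foot mY (\<sigma> a, s)"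
    by metis
  have sfoot: "\<psi> (foot mX l) = foot mY (lmap \<sigma> l)" if "fst l \<in> ?A" for l
    using \<sigma>(2)[OF that, of "snd l"] by (simp add: lmap_def)
  have inj: "inj_on \<sigma> ?A"
  proof (rule inj_onI)
    fix a b assume ab: "a \<in> ?A" "b \<in> ?A" "\<sigma> a = \<sigma> b"
    then have "\<psi> (foot mX (a, True)) = \<psi> (foot mX (b, True))" using \<sigma>(2) by simp
    then have "foot mX (a, True) = foot mX (b, True)"
      using psi vX[of "(a, True)"] vX[of "(b, True)"] ab by (auto simp: bij_betw_def inj_on_def)
    then show "a = b" using PX.foot_inject[of "(a, True)" "(b, True)"] ab by simp
  qed
  have "b \<in> \<sigma> ` ?A" if b: "b \<in> ?B" for b
  proof -
    have "foot mY (b, True) \<in> \<psi> ` vertices X mX"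
      using psi b by (auto simp: bij_betw_def vertices_eq)
    then obtain l where l: "fst l \<in> ?A" "foot mY (b, True) = \<psi> (foot mX l)" by (auto simp: vertices_eq)
    then have "(b, True) = lmap \<sigma> l"
      using PY.foot_inject[of "(b, True)" "lmap \<sigma> l"] sfoot b \<sigma>(1) by simp
    then show ?thesis using l(1) by (metis fst_conv image_eqI lmap_simps(1))
  qed
  then have bij: "bij_betw \<sigma> ?A ?B" using inj \<sigma>(1) by (auto simp: bij_betw_def)
  have "pingpong_iso ?A mX ?B mY \<sigma>"
    by unfold_locales (use bij ord vX sfoot in auto)
  moreover have "signed_letters Y (\<tau> f) = lmap \<sigma> ` signed_letters X f" if f: "f \<in> X" for f
  proof -
    have tf: "\<tau> f \<in> Y" using tau f by (auto simp: bij_betw_def)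
    have iff: "lmap \<sigma> l \<in> signed_letters Y (\<tau> f) \<longleftrightarrow> l \<in> signed_letters X f" if l: "fst l \<in> ?A" for l
    proof -
      have "\<psi> (foot mX (linv l)) = foot mY (linv (lmap \<sigma> l))"
        using sfoot[of "linv l"] l by (simp add: linv_def lmap_def)
      then show ?thesis
        using edge_iff_letter[OF ppX l f] edge_iff_letter[OF ppY _ tf, of "lmap \<sigma> l"] \<sigma>(1)[OF l]
          edge[of "foot mX (linv l)" "foot mX l" f] vX[OF l] vX[of "linv l"] sfoot[OF l] l f by simp
    qed
    show ?thesis
    proof (intro equalityI subsetI)
      fix k assume k: "k \<in> signed_letters Y (\<tau> f)"
      then have "fst k \<in> \<sigma> ` ?A" using bij by (auto simp: signed_letters_def bij_betw_def)
      then obtain a where "a \<in> ?A" "k = lmap \<sigma> (a, snd k)" by (auto simp: prod_eq_iff)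
      then show "k \<in> lmap \<sigma> ` signed_letters X f"
        using iff[of "(a, snd k)"] k by (metis fst_conv image_eqI)
    next
      fix k assume "k \<in> lmap \<sigma> ` signed_letters X f"
      then obtain l where "l \<in> signed_letters X f" "k = lmap \<sigma> l" by blast
      then show "k \<in> signed_letters Y (\<tau> f)" using iff[of l] by (simp add: signed_letters_def)
    qed
  qed
  ultimately show thesis using that by blast
qed

section \<open>The group generated by a fast set\<close>

text \<open>Pushes inversion down to the generators by carrying the property for \<open>g\<close>
  and \<open>inv g\<close> together.\<close>

lemma gen_induct_generators:
  assumes "g \<in> gen X" and bij: "\<And>f. f \<in> X \<Longrightarrow> bij f"
    and "P id" and "\<And>f. f \<in> X \<Longrightarrow> P f" and "\<And>f. f \<in> X \<Longrightarrow> P (inv f)"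
    and "\<And>f g. P f \<Longrightarrow> P g \<Longrightarrow> P (g \<circ> f)"
  shows "P g"
proof -
  have "bij g \<and> P g \<and> P (inv g)"
    using assms(1)
  proof induction
    case gen_id
    then show ?case using assms(3) by (metis bij_id inv_id)
  next
    case (gen_base f)
    then show ?case using assms by blast
  next
    case (gen_mult f g)
    then have "inv (g \<circ> f) = inv f \<circ> inv g" by (simp only: o_inv_distrib)
    then show ?case using assms(6) gen_mult.IH bij_comp by metis
  next
    case (gen_inv f)
    then show ?case by (simp add: bij_imp_bij_inv inv_inv_eq)
  qed
  then show ?thesis by blast
qed

lemma gen_homeo:
  assumes "g \<in> gen X" "\<And>f. f \<in> X \<Longrightarrow> homeo_plus f"
  shows "homeo_plus g"
  using assms(1)
  by induction (blast intro: assms(2) homeo_plus_id homeo_plus_comp homeo_plus_inv)+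

section \<open>A fast set with canonical marking, and its action on \<open>pts\<close>\<close>

locale fast_group = marked_pingpong "bumps_used X" m "{a \<in> bumps_used X. initial (bumps_used X) a}"
  for X m +
  assumes homeo: "f \<in> X \<Longrightarrow> homeo_plus f"
    and all_canonical: "a \<in> bumps_used X \<Longrightarrow> canonical a"
begin

lemma signed_letters_bumps: "l \<in> signed_letters X f \<Longrightarrow> fst l \<in> bumps_used X"
  and inverse_signed_letters_bumps: "l \<in> linv ` signed_letters X f \<Longrightarrow> fst l \<in> bumps_used X"
  by (auto simp: signed_letters_def)

lemma acts_generator:
  assumes "f \<in> X"
  shows "acts f (signed_letters X f)" "acts (inv f) (linv ` signed_letters X f)"
proof -
  show "acts f (signed_letters X f)" using acts_signed_letters assms homeo by blast
  then show "acts (inv f) (linv ` signed_letters X f)"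
    using acts_inv homeo_plus_bij homeo assms pos signed_letters_bumps by blast
qed

lemma gen_pts:
  assumes "g \<in> gen X" "t \<in> pts"
  shows "g t \<in> pts"
proof -
  have "\<forall>t\<in>pts. g t \<in> pts"
  proof (rule gen_induct_generators[OF assms(1)])
    fix f assume f: "f \<in> X"
    then show "bij f" using homeo homeo_plus_bij by blast
    show "\<forall>t\<in>pts. f t \<in> pts"
      using acts_pts[OF acts_generator(1)[OF f]] signed_letters_bumps by blast
    show "\<forall>t\<in>pts. inv f t \<in> pts"
      using acts_pts[OF acts_generator(2)[OF f]] inverse_signed_letters_bumps by blast
  qed auto
  then show ?thesis using assms(2) by blast
qed

lemma gen_traced:
  assumes "g \<in> gen X"
  shows "\<exists>k. traced g k"
proof (rule gen_induct_generators[OF assms])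
  fix f assume f: "f \<in> X"
  then show "bij f" using homeo homeo_plus_bij by blast
  show "\<exists>k. traced f k" using traced_acts[OF acts_generator(1)[OF f]] signed_letters_bumps by blast
  show "\<exists>k. traced (inv f) k"
    using traced_acts[OF acts_generator(2)[OF f]] inverse_signed_letters_bumps by blast
qed (use traced_id traced_comp in blast)+

lemma gen_faithful:
  assumes "g \<in> gen X" "\<And>t. t \<in> pts \<Longrightarrow> g t = t"
  shows "g = id"
  using faithful gen_homeo gen_traced assms homeo by metis

text \<open>Generators and their inverses preserve \<open>pts\<close>. Conversely, on a point of its
  support a letter acts as the generator using its bump or as the inverse of that generator.\<close>

lemma Mgen_eq_pts: "Mgen X = pts"
proof -
  have M0: "M0 X = m ` {a \<in> bumps_used X. initial (bumps_used X) a}"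
    using all_canonical by (force simp: M0_def canonical_def)
  show ?thesis
  proof (intro equalityI subsetI)
    fix t assume "t \<in> Mgen X"
    then obtain a g where "t = g (m a)" "a \<in> bumps_used X" "g \<in> gen X"
      by (auto simp: Mgen_def M0)
    then show "t \<in> pts" using gen_pts marker_in_pts by blast
  next
    fix t assume "t \<in> pts"
    then obtain a u where a: "a \<in> bumps_used X" "initial (bumps_used X) a"
      and u: "t = ev (m a) u" "reduced_stack (bumps_used X) m (m a) u"
      by (auto simp: pts_def)
    have "\<exists>g\<in>gen X. ev (m a) u = g (m a)" using u(2)
    proof (induction u)
      case Nil
      show ?case by (rule bexI[of _ id]) (auto intro: gen_id)
    next
      case (Cons l u)
      then obtain g where g: "g \<in> gen X" "ev (m a) u = g (m a)" by auto
      let ?t = "ev (m a) u"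
      \<comment> \<open>\<open>s\<close> is the sign with which \<open>f\<close> uses the bump of
        \<open>l\<close>; comparing it with the sign of \<open>l\<close> decides between
        \<open>f\<close> and \<open>inv f\<close>.\<close>
      obtain f s where f: "f \<in> X" "(fst l, s) \<in> signed_letters X f"
        using Cons.prems bumps_used_iff[of "fst l" X] by (auto simp: signed_letters_def)
      have "\<exists>h\<in>gen X. lact l ?t = h ?t"
      proof (cases "snd l = s")
        case True
        then have "l \<in> signed_letters X f" using f(2) by (cases l) simp
        then have "f ?t = lact l ?t" using acts_generator(1)[OF f(1)] Cons.prems by (simp add: acts_def)
        then show ?thesis using gen_base[OF f(1)] by metis
      next
        case False
        then have "l = linv (fst l, s)" by (auto simp: linv_def prod_eq_iff)
        then have "l \<in> linv ` signed_letters X f" using f(2) by blast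
        then have "inv f ?t = lact l ?t" using acts_generator(2)[OF f(1)] Cons.prems unfolding acts_def by auto
        then show ?thesis using gen_inv[OF gen_base[OF f(1)]] by metis
      qed
      then obtain h where h: "h \<in> gen X" "lact l ?t = h ?t" by blast
      then have "ev (m a) (l # u) = (h \<circ> g) (m a)" using g(2) by simp
      then show ?case using gen_mult[OF g(1) h(1)] by blast
    qed
    then show "t \<in> Mgen X" using a u(1) unfolding Mgen_def M0 by blast
  qed
qed

end

lemma fast_group_exists:
  assumes homeo: "\<forall>f\<in>X. homeo_plus f" and "finite (trans_pts X)" and pp: "pingpong (bumps_used X) mX"
  obtains m where "fast_group X m"
proof -
  let ?A = "bumps_used X"
  have "lo ` ?A \<subseteq> trans_pts X" using lo_in_trans_pts homeo by blast
  then have "finite (lo ` ?A)" using assms(2) finite_subset by blast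
  then have fin: "finite ?A"
    using finite_imageD pingpong.lo_inject[OF pp] by (meson inj_onI)
  obtain m where m: "pingpong ?A m" "\<forall>a\<in>?A. pingpong.canonical ?A m a"
    using canonical_marking_exists[OF pp fin] by blast
  interpret pingpong ?A m by (rule m(1))
  have "fast_group X m"
  proof unfold_locales
    fix a and l :: letter assume "a \<in> {a \<in> ?A. initial ?A a}" "fst l \<in> ?A"
    then show "m a \<notin> foot m l" using initial_marker_avoids_feet fin m(2) by simp
  next
    fix a assume "a \<in> ?A" "a \<notin> {a \<in> ?A. initial ?A a}"
    then show "\<exists>d\<in>?A. lo d < lo a \<and> m a = d (m d)" using m(2) by (auto simp: canonical_def)
  qed (use fin homeo m(2) in auto)
  then show thesis using that by blast
qed

context pingpong
begin

text \<open>The source of \<open>a\<close> ends exactly at \<open>m a\<close> and so represents the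
  marker in the order of the feet. This puts corresponding initial markers into corresponding
  gaps.\<close>

lemma foot_less_marker_iff:
  assumes a: "a \<in> A" and l: "fst l \<in> A" and out: "m a \<notin> foot m l"
  shows "foot_less (foot m l) {m a} \<longleftrightarrow> l = (a, False) \<or> foot_less (foot m l) (foot m (a, False))"
proof (cases "l = (a, False)")
  case True
  then show ?thesis by (simp add: foot_less_def mem_foot_iff)
next
  case False
  obtain t where t: "t \<in> foot m l" using foot_nonempty l by blast
  have "t < m a \<longleftrightarrow> foot_less (foot m l) (foot m (a, False))"
  proof
    assume "t < m a"
    then obtain u where u: "max (lo a) t < u" "u < m a"
      using dense[of "max (lo a) t" "m a"] marker[OF a] by auto
    then have "u \<in> foot m (a, False)" by (simp add: mem_foot_iff)
    then show "foot_less (foot m l) (foot m (a, False))" using foot_less_iff[OF l _ False t] a u by simp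
  next
    assume less: "foot_less (foot m l) (foot m (a, False))"
    obtain u where u: "u \<in> foot m (a, False)" using foot_nonempty[of "(a, False)"] a by auto
    then have "t < u" using less t by (auto simp: foot_less_def)
    then show "t < m a" using u by (simp add: mem_foot_iff)
  qed
  then show ?thesis using False foot_less_point[OF out t] by simp
qed

lemma marker_less_iff:
  assumes "a \<in> A" "b \<in> A"
  shows "m a < m b \<longleftrightarrow> foot_less (foot m (a, False)) (foot m (b, False))"
proof (cases "a = b")
  case True
  then show ?thesis using foot_less_irrefl[of "(a, False)"] assms by simp
next
  case False
  obtain s t where st: "s \<in> foot m (a, False)" "t \<in> foot m (b, False)"
    using foot_nonempty[of "(a, False)"] foot_nonempty[of "(b, False)"] assms by auto
  have "foot_less (foot m (a, False)) (foot m (b, False)) \<longleftrightarrow> s < t"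
    using foot_less_iff[OF _ _ _ st] assms False by simp
  then show ?thesis
    using st src_src_apart[OF assms False] marker[OF assms(1)] marker[OF assms(2)]
    by (auto simp: mem_foot_iff)
qed

end

text \<open>The subgroup of the product generated by the pairs \<open>(f, \<tau> f)\<close>: the
  graph of \<phi>, before it is known to be a function.\<close>

inductive gen_pair :: "(real \<Rightarrow> real) set \<Rightarrow> ((real \<Rightarrow> real) \<Rightarrow> (real \<Rightarrow> real)) \<Rightarrow>
    (real \<Rightarrow> real) \<Rightarrow> (real \<Rightarrow> real) \<Rightarrow> bool" for X \<tau> where
  pair_id: "gen_pair X \<tau> id id"
| pair_base: "f \<in> X \<Longrightarrow> gen_pair X \<tau> f (\<tau> f)"
| pair_mult: "gen_pair X \<tau> f f' \<Longrightarrow> gen_pair X \<tau> g g' \<Longrightarrow> gen_pair X \<tau> (g \<circ> f) (g' \<circ> f')"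
| pair_inv: "gen_pair X \<tau> f f' \<Longrightarrow> gen_pair X \<tau> (inv f) (inv f')"

text \<open>Pairs in \<open>gen_pair\<close> correspond under \<theta>. Hence faithfulness on
  \<open>N\<close> makes the relation a function and faithfulness on \<open>M\<close> makes it
  injective.\<close>

lemma group_iso_of_equivariant_bij:
  assumes \<tau>: "bij_betw \<tau> X Y" and \<theta>: "bij_betw \<theta> M N"
    and bijX: "\<And>f. f \<in> gen X \<Longrightarrow> bij f" and bijY: "\<And>f. f \<in> gen Y \<Longrightarrow> bij f"
    and inv: "\<And>f t. f \<in> gen X \<Longrightarrow> t \<in> M \<Longrightarrow> f t \<in> M"
    and equiv: "\<And>f t. f \<in> X \<Longrightarrow> t \<in> M \<Longrightarrow> \<theta> (f t) = \<tau> f (\<theta> t)"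
    and faithX: "\<And>f. f \<in> gen X \<Longrightarrow> (\<And>t. t \<in> M \<Longrightarrow> f t = t) \<Longrightarrow> f = id"
    and faithY: "\<And>f. f \<in> gen Y \<Longrightarrow> (\<And>t. t \<in> N \<Longrightarrow> f t = t) \<Longrightarrow> f = id"
  shows "\<exists>\<phi>. group_iso_on (gen X) (gen Y) \<phi> \<and> (\<forall>f\<in>X. \<phi> f = \<tau> f) \<and>
    (\<forall>f\<in>gen X. \<forall>t\<in>M. \<theta> (f t) = \<phi> f (\<theta> t))"
proof -
  have pair: "f \<in> gen X \<and> f' \<in> gen Y \<and> (\<forall>t\<in>M. \<theta> (f t) = f' (\<theta> t))" if "gen_pair X \<tau> f f'" for f f'
    using that
  proof induction
    case pair_id
    show ?case by (intro conjI gen_id ballI) simp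
  next
    case (pair_base f)
    then show ?case using equiv \<tau> by (auto simp: bij_betw_def intro: gen_base)
  next
    case (pair_mult f f' g g')
    then show ?case using inv by (metis comp_apply gen_mult)
  next
    case (pair_inv f f')
    have "\<theta> (inv f t) = inv f' (\<theta> t)" if t: "t \<in> M" for t
    proof -
      have "inv f t \<in> M" using inv gen_inv pair_inv t by blast
      then have "\<theta> (f (inv f t)) = f' (\<theta> (inv f t))" using pair_inv by blast
      then have "\<theta> t = f' (\<theta> (inv f t))" using bijX pair_inv by (simp add: bij_is_surj surj_f_inv_f)
      then show ?thesis using bijY pair_inv by (simp add: bij_is_inj)
    qed
    then show ?case using pair_inv by (auto intro: gen_inv)
  qed
  have exX: "\<exists>f'. gen_pair X \<tau> f f'" if "f \<in> gen X" for f
    using that by induction (blast intro: gen_pair.intros)+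
  have exY: "\<exists>f. gen_pair X \<tau> f f'" if "f' \<in> gen Y" for f'
    using that
  proof induction
    case (gen_base g)
    then obtain f where "f \<in> X" "g = \<tau> f" using \<tau> by (auto simp: bij_betw_def)
    then show ?case using pair_base by blast
  qed (blast intro: gen_pair.intros)+
  have eq_of_agree: "f = g"
    if "f \<in> G" "g \<in> G" "\<And>f. f \<in> G \<Longrightarrow> bij f" "\<And>t. t \<in> K \<Longrightarrow> f t = g t"
      "\<And>f g. f \<in> G \<Longrightarrow> g \<in> G \<Longrightarrow> g \<circ> f \<in> G" "\<And>f. f \<in> G \<Longrightarrow> inv f \<in> G"
      "\<And>f. f \<in> G \<Longrightarrow> (\<And>t. t \<in> K \<Longrightarrow> f t = t) \<Longrightarrow> f = id"
    for f g :: "real \<Rightarrow> real" and G and K :: "real set"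
  proof -
    have "inv g (f t) = t" if "t \<in> K" for t
      using that \<open>\<And>t. t \<in> K \<Longrightarrow> f t = g t\<close> \<open>\<And>f. f \<in> G \<Longrightarrow> bij f\<close>[OF \<open>g \<in> G\<close>] by (simp add: bij_is_inj)
    then have "inv g \<circ> f = id" using that by simp
    then have "g \<circ> (inv g \<circ> f) = g" by simp
    then show "f = g" using that(3)[OF \<open>g \<in> G\<close>] by (metis bij_is_surj comp_assoc id_comp surj_iff)
  qed
  have functional: "f' = f''" if "gen_pair X \<tau> f f'" "gen_pair X \<tau> f f''" for f f' f''
  proof (rule eq_of_agree[of f' "gen Y" f'' N])
    fix t assume "t \<in> N"
    then obtain s where "s \<in> M" "t = \<theta> s" using \<theta> by (auto simp: bij_betw_def)
    then show "f' t = f'' t" using pair that by metis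
  qed (use pair that bijY faithY in \<open>auto intro: gen_mult gen_inv\<close>)
  have injective: "f = g" if "gen_pair X \<tau> f f'" "gen_pair X \<tau> g f'" for f g f'
  proof (rule eq_of_agree[of f "gen X" g M])
    fix t assume t: "t \<in> M"
    then have "\<theta> (f t) = \<theta> (g t)" using pair that by metis
    moreover have "f t \<in> M" "g t \<in> M" using pair that inv t by blast+
    ultimately show "f t = g t" using \<theta> by (auto simp: bij_betw_def inj_on_def)
  qed (use pair that bijX faithX in \<open>auto intro: gen_mult gen_inv\<close>)
  obtain \<phi> where \<phi>: "\<And>f. f \<in> gen X \<Longrightarrow> gen_pair X \<tau> f (\<phi> f)" using exX by metis
  have "bij_betw \<phi> (gen X) (gen Y)"
    unfolding bij_betw_def
  proof (intro conjI equalityI subsetI)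
    show "inj_on \<phi> (gen X)" using \<phi> injective by (metis inj_onI)
    show "f' \<in> gen Y" if "f' \<in> \<phi> ` gen X" for f' using that \<phi> pair by blast
    show "f' \<in> \<phi> ` gen X" if "f' \<in> gen Y" for f'
      using exY[OF that] \<phi> pair functional by (metis image_eqI)
  qed
  moreover have "\<phi> (g \<circ> f) = \<phi> g \<circ> \<phi> f" if "f \<in> gen X" "g \<in> gen X" for f g
    using functional[OF \<phi>[OF gen_mult[OF that]] pair_mult[OF \<phi>[OF that(1)] \<phi>[OF that(2)]]] .
  moreover have "\<phi> f = \<tau> f" if "f \<in> X" for f
    using functional[OF \<phi>[OF gen_base[OF that]] pair_base[OF that]] .
  ultimately show ?thesis
    using \<phi> pair unfolding group_iso_on_def by (intro exI[of _ \<phi>]) blast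
qed

theorem theorem1p1:
  fixes X Y :: "(real \<Rightarrow> real) set"
    and mX mY :: "(real \<Rightarrow> real) \<Rightarrow> real"
    and \<psi> :: "real set \<Rightarrow> real set"
    and \<tau> :: "(real \<Rightarrow> real) \<Rightarrow> (real \<Rightarrow> real)"
  assumes "\<forall>f\<in>X. homeo_plus f" and "\<forall>g\<in>Y. homeo_plus g"
    and "geom_fast X" and "geom_fast Y"
    and "finite (trans_pts X)" and "finite (trans_pts Y)"
    and "fast_marking (bumps_used X) mX" and "fast_marking (bumps_used Y) mY"
    and "diagram_iso X mX Y mY \<psi> \<tau>"
  shows "\<exists>\<phi>. group_iso_on (gen X) (gen Y) \<phi> \<and> (\<forall>f\<in>X. \<phi> f = \<tau> f) \<and>
           (\<exists>\<theta>. bij_betw \<theta> (Mgen X) (Mgen Y) \<and> strict_mono_on (Mgen X) \<theta> \<and>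
              (\<forall>f\<in>gen X. \<forall>t\<in>Mgen X. \<theta> (f t) = \<phi> f (\<theta> t)))"
proof -
  let ?A = "bumps_used X" and ?B = "bumps_used Y"
  let ?I = "{a \<in> ?A. initial ?A a}" and ?J = "{b \<in> ?B. initial ?B b}"
  have ppX: "pingpong ?A mX" and ppY: "pingpong ?B mY"
    using assms(7,8) by (auto simp: pingpong_def bumps_used_iff)
  obtain m where "fast_group X m" using fast_group_exists[OF assms(1,5) ppX] by blast
  then interpret GX: fast_group X m .
  obtain n where "fast_group Y n" using fast_group_exists[OF assms(2,6) ppY] by blast
  then interpret GY: fast_group Y n .
  obtain \<sigma> where s0: "pingpong_iso ?A mX ?B mY \<sigma>"
    and letters: "\<And>f. f \<in> X \<Longrightarrow> signed_letters Y (\<tau> f) = lmap \<sigma> ` signed_letters X f"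
    using diagram_iso_bumps[OF assms(9) ppX ppY] by blast
  have ppm: "pingpong ?A m" and ppn: "pingpong ?B n" by unfold_locales
  \<comment> \<open>The diagrams come with arbitrary markings, the stacks use canonical ones; the
    order of the feet is the same for both.\<close>
  interpret S: pingpong_iso ?A m ?B n \<sigma>
  proof unfold_locales
    show bij: "bij_betw \<sigma> ?A ?B" using s0 by (rule pingpong_iso.sigma_bij)
    fix k l :: letter assume kl: "fst k \<in> ?A" "fst l \<in> ?A"
    then have "fst (lmap \<sigma> k) \<in> ?B" "fst (lmap \<sigma> l) \<in> ?B" using bij by (auto simp: bij_betw_def)
    then show "foot_less (foot m k) (foot m l) \<longleftrightarrow>
        foot_less (foot n (lmap \<sigma> k)) (foot n (lmap \<sigma> l))"
      using foot_less_marking_independent[OF ppm ppX kl]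
        foot_less_marking_independent[OF ppn ppY, of "lmap \<sigma> k" "lmap \<sigma> l"]
        pingpong_iso.sigma_order[OF s0 kl] by blast
  qed
  have "\<not> initial ?A a \<longleftrightarrow> \<not> initial ?B (\<sigma> a)" if a: "a \<in> ?A" for a
  proof -
    have "(\<exists>d\<in>?A. d \<noteq> a \<and> foot_less (foot m (a, False)) (foot m (d, True)) \<and>
        (\<forall>k. fst k \<in> ?A \<longrightarrow> \<not> (foot_less (foot m (a, False)) (foot m k) \<and> foot_less (foot m k) (foot m (d, True)))))
      \<longleftrightarrow> (\<exists>d\<in>?A. \<sigma> d \<noteq> \<sigma> a \<and> foot_less (foot n (\<sigma> a, False)) (foot n (\<sigma> d, True)) \<and>
        (\<forall>k. fst k \<in> ?A \<longrightarrow> \<not> (foot_less (foot n (\<sigma> a, False)) (foot n (lmap \<sigma> k)) \<and>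
          foot_less (foot n (lmap \<sigma> k)) (foot n (\<sigma> d, True)))))"
      using S.sigma_order[of "(a, False)"] S.sigma_order[of _ "(_, True)"] a
      by (intro bex_cong refl conj_cong all_cong) (simp_all add: S.sigma_eq_iff)
    also have "\<dots> \<longleftrightarrow> (\<exists>e\<in>?B. e \<noteq> \<sigma> a \<and> foot_less (foot n (\<sigma> a, False)) (foot n (e, True)) \<and>
        (\<forall>j. fst j \<in> ?B \<longrightarrow> \<not> (foot_less (foot n (\<sigma> a, False)) (foot n j) \<and>
          foot_less (foot n j) (foot n (e, True)))))"
    proof -
      have B: "?B = \<sigma> ` ?A" using S.sigma_bij by (simp add: bij_betw_def)
      have "(\<forall>j. fst j \<in> ?B \<longrightarrow> P j) \<longleftrightarrow> (\<forall>k. fst k \<in> ?A \<longrightarrow> P (lmap \<sigma> k))" for P :: "letter \<Rightarrow> bool"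
        unfolding B by (auto simp: lmap_def)
      moreover have "(\<exists>e\<in>?B. Q e) \<longleftrightarrow> (\<exists>d\<in>?A. Q (\<sigma> d))" for Q unfolding B by blast
      ultimately show ?thesis by (simp only:)
    qed
    finally show ?thesis
      using GX.noninitial_iff[OF GX.finite_A a GX.all_canonical[OF a]]
        GY.noninitial_iff[OF GY.finite_A S.sigma_mem[OF a] GY.all_canonical[OF S.sigma_mem[OF a]]]
      by blast
  qed
  then have initial_iff: "\<sigma> a \<in> ?J \<longleftrightarrow> a \<in> ?I" if "a \<in> ?A" for a using that S.sigma_mem by auto
  have gap: "S.same_gap (m a) (n (\<sigma> a))" if a: "a \<in> ?I" for a
    unfolding S.same_gap_def
  proof (intro allI impI conjI)
    fix l :: letter assume l: "fst l \<in> ?A"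
    have sa: "\<sigma> a \<in> ?J" using initial_iff a by blast
    show out: "m a \<notin> foot m l" using GX.initial_marker[OF a l] .
    show out': "n (\<sigma> a) \<notin> foot n (lmap \<sigma> l)" using GY.initial_marker[OF sa] S.sigma_mem[OF l] by simp
    show "foot_less (foot m l) {m a} \<longleftrightarrow> foot_less (foot n (lmap \<sigma> l)) {n (\<sigma> a)}"
      using GX.foot_less_marker_iff[OF _ l out] GY.foot_less_marker_iff[OF _ _ out'] a sa
        S.sigma_mem[OF l] S.sigma_order[OF l, of "(a, False)"] S.lmap_eq_iff[OF l, of "(a, False)"]
      by simp
  qed
  let ?L = "map (lmap \<sigma>)"
  have transfer: "reduced_stack ?A m (m a) u \<longleftrightarrow> reduced_stack ?B n (n (\<sigma> a)) (?L u)"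
    if "a \<in> ?I" "\<And>l. l \<in> set u \<Longrightarrow> fst l \<in> ?A" for a u
    using S.reduced_transfer[of "[]" "m a" "n (\<sigma> a)" u] gap that by simp
  have red: "reduced_stack ?B n (n (\<sigma> a)) (?L u)" if "a \<in> ?I" "reduced_stack ?A m (m a) u" for a u
    using transfer[OF that(1)] reduced_letters[OF that(2)] that(2) by blast
  have less: "ev (m a) u < ev (m b) v \<longleftrightarrow> ev (n (\<sigma> a)) (?L u) < ev (n (\<sigma> b)) (?L v)"
    if "a \<in> ?I" "b \<in> ?I" "reduced_stack ?A m (m a) u" "reduced_stack ?A m (m b) v" for a b u v
  proof (rule S.ev_less_iff)
    show "m a < m b \<longleftrightarrow> n (\<sigma> a) < n (\<sigma> b)"
      using GX.marker_less_iff[of a b] GY.marker_less_iff[of "\<sigma> a" "\<sigma> b"] that S.sigma_mem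
        S.sigma_order[of "(a, False)" "(b, False)"] by simp
  qed (use that gap red in blast)+
  \<comment> \<open>A point goes to the value of its stack translated by \<sigma>. The choice of the
    stack is harmless: \<open>less\<close> in both directions shows that equal points have equal
    images.\<close>
  define \<theta> where "\<theta> t = (SOME t'. \<exists>a u. a \<in> ?I \<and> reduced_stack ?A m (m a) u \<and> t = ev (m a) u \<and>
    t' = ev (n (\<sigma> a)) (?L u))" for t
  have \<theta>: "\<theta> (ev (m a) u) = ev (n (\<sigma> a)) (?L u)" if au: "a \<in> ?I" "reduced_stack ?A m (m a) u" for a u
  proof -
    have "\<exists>b v. b \<in> ?I \<and> reduced_stack ?A m (m b) v \<and> ev (m a) u = ev (m b) v \<and>
        \<theta> (ev (m a) u) = ev (n (\<sigma> b)) (?L v)"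
      unfolding \<theta>_def by (rule someI_ex) (use au in blast)
    then obtain b v where bv: "b \<in> ?I" "reduced_stack ?A m (m b) v" "ev (m a) u = ev (m b) v"
      "\<theta> (ev (m a) u) = ev (n (\<sigma> b)) (?L v)" by blast
    then have "ev (n (\<sigma> a)) (?L u) = ev (n (\<sigma> b)) (?L v)"
      using less[OF au(1) bv(1) au(2) bv(2)] less[OF bv(1) au(1) bv(2) au(2)] by linarith
    then show ?thesis using bv(4) by simp
  qed
  have mono: "strict_mono_on GX.pts \<theta>"
    by (rule strict_mono_onI) (auto simp: GX.pts_def \<theta> less)
  have "\<theta> ` GX.pts = GY.pts"
  proof (intro equalityI subsetI)
    fix t assume "t \<in> \<theta> ` GX.pts"
    then obtain a u where au: "a \<in> ?I" "reduced_stack ?A m (m a) u" "t = \<theta> (ev (m a) u)"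
      by (auto simp: GX.pts_def)
    then have "t = ev (n (\<sigma> a)) (?L u)" using \<theta> by blast
    then show "t \<in> GY.pts" using GY.ptsI[of "\<sigma> a"] red[OF au(1,2)] initial_iff au(1) by blast
  next
    fix t assume "t \<in> GY.pts"
    then obtain b w where bw: "b \<in> ?J" "reduced_stack ?B n (n b) w" "t = ev (n b) w"
      by (auto simp: GY.pts_def)
    have B: "?B = \<sigma> ` ?A" using S.sigma_bij by (simp add: bij_betw_def)
    then obtain a where a: "a \<in> ?A" "b = \<sigma> a" using bw(1) by blast
    then have aI: "a \<in> ?I" using initial_iff bw(1) by blast
    let ?inv = "inv_into ?A \<sigma>"
    let ?u = "map (lmap ?inv) w"
    have wB: "fst l \<in> \<sigma> ` ?A" if "l \<in> set w" for l using reduced_letters[OF bw(2) that] B by simp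
    have "?L ?u = w"
      using wB by (auto simp: lmap_def f_inv_into_f comp_def intro!: map_idI)
    moreover have "\<And>l. l \<in> set ?u \<Longrightarrow> fst l \<in> ?A" using wB by (force intro: inv_into_into)
    ultimately have "reduced_stack ?A m (m a) ?u" using transfer[OF aI, of ?u] bw(2) a(2) by simp
    then show "t \<in> \<theta> ` GX.pts"
      using \<theta>[OF aI, of ?u] GX.ptsI[OF aI, of ?u] \<open>?L ?u = w\<close> bw(3) a(2) by (metis image_eqI)
  qed
  then have \<theta>_bij: "bij_betw \<theta> GX.pts GY.pts"
    using mono by (simp add: bij_betw_def strict_mono_on_imp_inj_on)
  have tau: "bij_betw \<tau> X Y" using assms(9) by (simp add: diagram_iso_def)
  have equiv: "\<theta> (f t) = \<tau> f (\<theta> t)" if f: "f \<in> X" and t: "t \<in> GX.pts" for f t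
  proof -
    obtain a u where au: "a \<in> ?I" "reduced_stack ?A m (m a) u" "t = ev (m a) u"
      using t by (auto simp: GX.pts_def)
    have "\<tau> f \<in> Y" using tau f by (auto simp: bij_betw_def)
    then have "acts (\<tau> f) (lmap \<sigma> ` signed_letters X f)"
      using GY.acts_generator(1) letters[OF f] by metis
    then obtain v where "reduced_stack ?A m (m a) v" "f t = ev (m a) v" "\<tau> f (ev (n (\<sigma> a)) (?L u)) = ev (n (\<sigma> a)) (?L v)"
      using S.simulate[OF au(2) red[OF au(1,2)], of "signed_letters X f" f "\<tau> f"] gap[OF au(1)]
        GX.acts_generator(1)[OF f] GX.signed_letters_bumps au(3) by blast
    then show ?thesis using \<theta> au by simp
  qed
  have homeoX: "\<And>f. f \<in> gen X \<Longrightarrow> bij f" and homeoY: "\<And>f. f \<in> gen Y \<Longrightarrow> bij f"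
    using gen_homeo homeo_plus_bij assms(1,2) by blast+
  have "\<exists>\<phi>. group_iso_on (gen X) (gen Y) \<phi> \<and> (\<forall>f\<in>X. \<phi> f = \<tau> f) \<and>
    (\<forall>f\<in>gen X. \<forall>t\<in>GX.pts. \<theta> (f t) = \<phi> f (\<theta> t))"
  proof (rule group_iso_of_equivariant_bij[OF tau \<theta>_bij])
    show "f t \<in> GX.pts" if "f \<in> gen X" "t \<in> GX.pts" for f t using GX.gen_pts[OF that] .
    show "\<theta> (f t) = \<tau> f (\<theta> t)" if "f \<in> X" "t \<in> GX.pts" for f t using equiv[OF that] .
    show "f = id" if "f \<in> gen X" "\<And>t. t \<in> GX.pts \<Longrightarrow> f t = t" for f using GX.gen_faithful[OF that] .
    show "f = id" if "f \<in> gen Y" "\<And>t. t \<in> GY.pts \<Longrightarrow> f t = t" for f using GY.gen_faithful[OF that] .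
  qed (use homeoX homeoY in blast)+
  then show ?thesis
    using \<theta>_bij mono unfolding GX.Mgen_eq_pts GY.Mgen_eq_pts by blast
qed

end
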